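(* Let $G$ be an amenable locally compact group, let $(\Phi,\Psi)$ be a complementary pair of Young functions satisfying the $\Delta_2$-condition, and let $\Phi$ satisfy the MA-condition. Then $A_\Phi(G)$ is reflexive (as a Banach space) if and only if $G$ is finite.
   Context: $G$ carries a fixed left Haar measure $dx$. A Young function is a symmetric convex $\Phi:\mathbb{R}\to[0,\infty]$ with $\Phi(0)=0$ and $\lim_{x\to\infty}\Phi(x)=+\infty$; its complementary Young function is $\Psi(y)=\sup\{x|y|-\Phi(x):x\ge 0\}$. $\Phi$ satisfies the $\Delta_2$-condition if it is finite-valued and there are $M>0$, $x_0>0$ with $\Phi(2x)\le M\Phi(x)$ for all $x\ge x_0$ when $G$ is compact, and the same with $x_0=0$ when $G$ is non-compact; the pair $(\Phi,\Psi)$ satisfies $\Delta_2$ if both functions do. $\Phi$ satisfies the Milnes-Akimovič (MA) condition if for each $\epsilon>0$ there exist $\alpha_\epsilon>1$ and $x_1(\epsilon)\ge 0$ with $\Phi'((1+\epsilon)x)\ge\alpha_\epsilon\Phi'(x)$ for all $x\ge x_1(\epsilon)$, where $\Phi'$ is the (one-sided) derivative of the convex function $\Phi$. The Orlicz space $L^\Phi(G)$ consists of (classes of) measurable $f:G\to\mathbb{C}$ with $\int_G\Phi(\beta|f|)\,dx<\infty$ for some $\beta>0$, with the equivalent norms $N_\Phi(f)=\inf\{k>0:\int_G\Phi(|f|/k)\,dx\le 1\}$ and $\|f\|_\Phi=\sup\{\int_G|fg|\,dx: g\in L^\Psi(G),\ \int_G\Psi(|g|)\,dx\le 1\}$; similarly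 for $\Psi$. Write $\check g(x)=g(x^{-1})$ and $(f*g)(x)=\int_G f(y)g(y^{-1}x)\,dy$. The Orlicz Figà-Talamanca Herz algebra $A_\Phi(G)$ is the space of functions $u=\sum_n f_n*\check g_n$ with $f_n\in L^\Phi(G)$, $g_n\in L^\Psi(G)$, $\sum_n N_\Phi(f_n)\|g_n\|_\Psi<\infty$, normed by the infimum $\|u\|_{A_\Phi}$ of $\sum_n N_\Phi(f_n)\|g_n\|_\Psi$ over all such representations; with pointwise operations it is a commutative Banach algebra of functions in $C_0(G)$. *)

theory Defs
  imports "HOL-Analysis.Analysis"
begin

text \<open>
  Groups are written additively because the library's class for (not necessarily commutative)
  topological groups is \<open>topological_group_add\<close>; thus \<open>x\<inverse>\<close> reads \<open>- x\<close> and
  \<open>y\<inverse>x\<close> reads \<open>- y + x\<close>. The group is the whole type.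
\<close>

section \<open>Haar measure and amenability\<close>

text \<open>A nonzero left-invariant Radon measure on the Borel sets.\<close>

definition left_haar_measure :: "'a::topological_group_add measure \<Rightarrow> bool" where
  "left_haar_measure \<mu> \<longleftrightarrow>
     sets \<mu> = sets borel \<and>
     emeasure \<mu> UNIV \<noteq> 0 \<and>
     (\<forall>K. compact K \<longrightarrow> emeasure \<mu> K < \<infinity>) \<and>
     (\<forall>A \<in> sets borel. emeasure \<mu> A = (INF U\<in>{U. open U \<and> A \<subseteq> U}. emeasure \<mu> U)) \<and>
     (\<forall>U. open U \<longrightarrow> emeasure \<mu> U = (SUP K\<in>{K. compact K \<and> K \<subseteq> U}. emeasure \<mu> K)) \<and>
     (\<forall>a. \<forall>A \<in> sets borel. emeasure \<mu> ((+) a ` A) = emeasure \<mu> A)"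

text \<open>
  \<open>L\<^sup>\<infinity>(G)\<close> is represented by bounded Borel functions modulo locally null functions (null on every
  compact set), which is the appropriate notion when the group is not \<open>\<sigma>\<close>-compact. Positivity is
  required for functions that are nonnegative locally almost everywhere, so that a mean is
  well defined on classes.
\<close>

definition bounded_borel :: "('a::topological_space \<Rightarrow> real) set" where
  "bounded_borel = {f \<in> borel_measurable borel. bounded (range f)}"

definition left_invariant_mean ::
    "'a::topological_group_add measure \<Rightarrow> (('a \<Rightarrow> real) \<Rightarrow> real) \<Rightarrow> bool" where
  "left_invariant_mean \<mu> m \<longleftrightarrow>
     (\<forall>f \<in> bounded_borel. \<forall>g \<in> bounded_borel. m (\<lambda>x. f x + g x) = m f + m g) \<and>
     (\<forall>c. \<forall>f \<in> bounded_borel. m (\<lambda>x. c * f x) = c * m f) \<and>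
     (\<forall>f \<in> bounded_borel.
        (\<forall>K. compact K \<longrightarrow> emeasure \<mu> {x \<in> K. f x < 0} = 0) \<longrightarrow> 0 \<le> m f) \<and>
     m (\<lambda>_. 1) = 1 \<and>
     (\<forall>a. \<forall>f \<in> bounded_borel. m (\<lambda>x. f (a + x)) = m f)"

definition amenable :: "'a::topological_group_add measure \<Rightarrow> bool" where
  "amenable \<mu> \<longleftrightarrow> (\<exists>m. left_invariant_mean \<mu> m)"

section \<open>Young functions\<close>

definition young_function :: "(real \<Rightarrow> ereal) \<Rightarrow> bool" where
  "young_function \<Phi> \<longleftrightarrow>
     (\<forall>x. 0 \<le> \<Phi> x) \<and>
     (\<forall>x. \<Phi> (- x) = \<Phi> x) \<and>
     (\<forall>x y t. 0 \<le> t \<and> t \<le> 1 \<longrightarrow>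
        \<Phi> ((1 - t) * x + t * y) \<le> ereal (1 - t) * \<Phi> x + ereal t * \<Phi> y) \<and>
     \<Phi> 0 = 0 \<and>
     (\<Phi> \<longlongrightarrow> \<infinity>) at_top"

definition complementary_young :: "(real \<Rightarrow> ereal) \<Rightarrow> real \<Rightarrow> ereal" where
  "complementary_young \<Phi> y = (SUP x\<in>{0..}. ereal (x * \<bar>y\<bar>) - \<Phi> x)"

definition complementary_pair :: "(real \<Rightarrow> ereal) \<Rightarrow> (real \<Rightarrow> ereal) \<Rightarrow> bool" where
  "complementary_pair \<Phi> \<Psi> \<longleftrightarrow>
     young_function \<Phi> \<and> young_function \<Psi> \<and> \<Psi> = complementary_young \<Phi>"

definition delta2 :: "'a::topological_space set \<Rightarrow> (real \<Rightarrow> ereal) \<Rightarrow> bool" where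
  "delta2 G \<Phi> \<longleftrightarrow>
     (\<forall>x. \<Phi> x \<noteq> \<infinity>) \<and>
     (\<exists>M>0. \<exists>x0. (if compact G then x0 > 0 else x0 = 0) \<and>
        (\<forall>x\<ge>x0. \<Phi> (2 * x) \<le> ereal M * \<Phi> x))"

text \<open>
  The right derivative, meaningful for finite-valued \<open>\<Phi>\<close>. Since each one-sided derivative of a
  convex function is recovered from the other by one-sided limits, using the left derivative
  in the MA condition would at most change the threshold \<open>x1\<close>.
\<close>

definition young_deriv :: "(real \<Rightarrow> ereal) \<Rightarrow> real \<Rightarrow> real" where
  "young_deriv \<Phi> x = vector_derivative (\<lambda>t. real_of_ereal (\<Phi> t)) (at_right x)"

definition MA_condition :: "(real \<Rightarrow> ereal) \<Rightarrow> bool" where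
  "MA_condition \<Phi> \<longleftrightarrow>
     (\<forall>\<epsilon>>0. \<exists>\<alpha>>1. \<exists>x1\<ge>0. \<forall>x\<ge>x1.
        young_deriv \<Phi> ((1 + \<epsilon>) * x) \<ge> \<alpha> * young_deriv \<Phi> x)"

section \<open>Orlicz spaces\<close>

definition orlicz_modular :: "'a measure \<Rightarrow> (real \<Rightarrow> ereal) \<Rightarrow> ('a \<Rightarrow> complex) \<Rightarrow> ennreal" where
  "orlicz_modular \<mu> \<Phi> f = (\<integral>\<^sup>+ x. e2ennreal (\<Phi> (cmod (f x))) \<partial>\<mu>)"

text \<open>
  Functions rather than almost-everywhere classes: the norms and convolutions below depend only
  on the classes.
\<close>

definition orlicz_space :: "'a measure \<Rightarrow> (real \<Rightarrow> ereal) \<Rightarrow> ('a \<Rightarrow> complex) set" where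
  "orlicz_space \<mu> \<Phi> =
     {f \<in> borel_measurable \<mu>. \<exists>\<beta>>0. orlicz_modular \<mu> \<Phi> (\<lambda>x. of_real \<beta> * f x) < \<infinity>}"

definition luxemburg_norm :: "'a measure \<Rightarrow> (real \<Rightarrow> ereal) \<Rightarrow> ('a \<Rightarrow> complex) \<Rightarrow> ennreal" where
  "luxemburg_norm \<mu> \<Phi> f =
     (INF k\<in>{k. 0 < k \<and> orlicz_modular \<mu> \<Phi> (\<lambda>x. f x / of_real k) \<le> 1}. ennreal k)"

text \<open>
  The argument \<open>\<Theta>\<close> is the Young function complementary to the one naming the norm: for a
  complementary pair, \<open>\<parallel>f\<parallel>\<^sub>\<Phi> = orlicz_norm \<mu> \<Psi> f\<close> and \<open>\<parallel>g\<parallel>\<^sub>\<Psi> = orlicz_norm \<mu> \<Phi> g\<close>.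
\<close>

definition orlicz_norm :: "'a measure \<Rightarrow> (real \<Rightarrow> ereal) \<Rightarrow> ('a \<Rightarrow> complex) \<Rightarrow> ennreal" where
  "orlicz_norm \<mu> \<Theta> f =
     (SUP h\<in>{h \<in> orlicz_space \<mu> \<Theta>. orlicz_modular \<mu> \<Theta> h \<le> 1}.
        \<integral>\<^sup>+ x. ennreal (cmod (f x * h x)) \<partial>\<mu>)"

section \<open>The Orlicz Figa-Talamanca Herz algebra\<close>

definition convolution ::
    "'a::group_add measure \<Rightarrow> ('a \<Rightarrow> complex) \<Rightarrow> ('a \<Rightarrow> complex) \<Rightarrow> 'a \<Rightarrow> complex" where
  "convolution \<mu> f g x = (LINT y|\<mu>. f y * g (- y + x))"

definition check_fun :: "('a::group_add \<Rightarrow> complex) \<Rightarrow> 'a \<Rightarrow> complex" where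
  "check_fun g x = g (- x)"

definition A_cost ::
    "'a measure \<Rightarrow> (real \<Rightarrow> ereal) \<Rightarrow> (nat \<Rightarrow> 'a \<Rightarrow> complex) \<Rightarrow> (nat \<Rightarrow> 'a \<Rightarrow> complex) \<Rightarrow> ennreal" where
  "A_cost \<mu> \<Phi> f g = (\<Sum>n. luxemburg_norm \<mu> \<Phi> (f n) * orlicz_norm \<mu> \<Phi> (g n))"

definition A_representations ::
    "'a::group_add measure \<Rightarrow> (real \<Rightarrow> ereal) \<Rightarrow> (real \<Rightarrow> ereal) \<Rightarrow> ('a \<Rightarrow> complex)
      \<Rightarrow> ((nat \<Rightarrow> 'a \<Rightarrow> complex) \<times> (nat \<Rightarrow> 'a \<Rightarrow> complex)) set" where
  "A_representations \<mu> \<Phi> \<Psi> u =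
     {(f, g). (\<forall>n. f n \<in> orlicz_space \<mu> \<Phi>) \<and> (\<forall>n. g n \<in> orlicz_space \<mu> \<Psi>) \<and>
        A_cost \<mu> \<Phi> f g < \<infinity> \<and>
        (\<forall>x. (\<lambda>n. convolution \<mu> (f n) (check_fun (g n)) x) sums u x)}"

definition A_space ::
    "'a::group_add measure \<Rightarrow> (real \<Rightarrow> ereal) \<Rightarrow> (real \<Rightarrow> ereal) \<Rightarrow> ('a \<Rightarrow> complex) set" where
  "A_space \<mu> \<Phi> \<Psi> = {u. A_representations \<mu> \<Phi> \<Psi> u \<noteq> {}}"

definition A_norm ::
    "'a::group_add measure \<Rightarrow> (real \<Rightarrow> ereal) \<Rightarrow> (real \<Rightarrow> ereal) \<Rightarrow> ('a \<Rightarrow> complex) \<Rightarrow> real" where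
  "A_norm \<mu> \<Phi> \<Psi> u = enn2real (INF (f, g)\<in>A_representations \<mu> \<Phi> \<Psi> u. A_cost \<mu> \<Phi> f g)"

section \<open>Reflexivity of complex normed function spaces\<close>

text \<open>
  The library has no complex normed spaces with a carrier set, so duals are introduced for a
  vector space \<open>V\<close> of complex functions under pointwise operations with norm \<open>N\<close>. A functional
  is set to 0 outside \<open>V\<close>; the dual is thereby again a vector space of complex functions under
  pointwise operations, and the construction can be iterated.
\<close>

definition dual_space ::
    "('s \<Rightarrow> complex) set \<Rightarrow> (('s \<Rightarrow> complex) \<Rightarrow> real) \<Rightarrow> (('s \<Rightarrow> complex) \<Rightarrow> complex) set" where
  "dual_space V N =
     {\<phi>. (\<forall>u\<in>V. \<forall>v\<in>V. \<phi> (\<lambda>x. u x + v x) = \<phi> u + \<phi> v) \<and>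
         (\<forall>c. \<forall>u\<in>V. \<phi> (\<lambda>x. c * u x) = c * \<phi> u) \<and>
         (\<exists>C. \<forall>u\<in>V. cmod (\<phi> u) \<le> C * N u) \<and>
         (\<forall>u. u \<notin> V \<longrightarrow> \<phi> u = 0)}"

definition dual_norm ::
    "('s \<Rightarrow> complex) set \<Rightarrow> (('s \<Rightarrow> complex) \<Rightarrow> real) \<Rightarrow> (('s \<Rightarrow> complex) \<Rightarrow> complex) \<Rightarrow> real" where
  "dual_norm V N \<phi> = (SUP u\<in>{u\<in>V. N u \<le> 1}. cmod (\<phi> u))"

text \<open>Surjectivity of the canonical embedding into the bidual.\<close>

definition reflexive_space :: "('s \<Rightarrow> complex) set \<Rightarrow> (('s \<Rightarrow> complex) \<Rightarrow> real) \<Rightarrow> bool" where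
  "reflexive_space V N \<longleftrightarrow>
     (\<forall>F \<in> dual_space (dual_space V N) (dual_norm V N).
        \<exists>u\<in>V. \<forall>\<phi>\<in>dual_space V N. F \<phi> = \<phi> u)"

end

theory Submission
  imports Defs
begin

text \<open>
  For a Borel set \<open>E\<close> of finite positive measure the function \<open>u\<^sub>E(x) = \<mu>(E \<inter> xE) / \<mu> E\<close> lies in the
  unit ball of \<open>A\<^sub>\<Phi>\<close>, and point evaluations are contractive. If \<open>A\<^sub>\<Phi>\<close> is reflexive, iterated limits
  of \<open>u\<^sub>E(x)\<close> in \<open>E\<close> and \<open>x\<close> can be interchanged. On a nondiscrete group take \<open>E\<close> shrinking to the
  identity and \<open>x\<close> tending to the identity: one iterated limit is 0, the other is at least 1/2.
  On an infinite discrete group take Foelner sets \<open>E\<close>, obtained from the invariant mean through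
  paradoxical decompositions, and \<open>x\<close> tending to infinity: the iterated limits differ again.
  On a finite group \<open>A\<^sub>\<Phi>\<close> consists of all functions and is finite-dimensional.
\<close>

section \<open>Reflexivity and interchange of limits\<close>

text \<open>The two infinite cases are one scheme with the roles of two disjoint closed sets
  exchanged, \<open>{0}\<close> and the half-plane of real part at least 1/2. A general group offers
  no sequence of sets E to pass to the limit with. The limit in E is therefore taken over finite
  sets X of points: for each X a single E has to be found whose overlap function lies in one closed
  set on X and eventually in the other along a filter. The case split is forced. On a discrete
  group, sets shrinking to the identity end at the identity itself, whose overlap function is a
  point mass, and nothing remains to converge. There the overlap must instead be large at arbitrary
  prescribed points, which is where amenability enters. Any fixed positive lower bound would
  separate the two sets, so the crude expansion factor 3/2 is enough, and a cruder form of Foelner's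
  condition than the usual one can be used.\<close>

lemma dual_space_add:
  assumes "\<psi> \<in> dual_space V N" "\<theta> \<in> dual_space V N"
  shows "(\<lambda>u. \<psi> u + \<theta> u) \<in> dual_space V N"
proof -
  have "\<exists>C. \<forall>u\<in>V. cmod (\<psi> u) \<le> C * N u" "\<exists>C. \<forall>u\<in>V. cmod (\<theta> u) \<le> C * N u"
    using assms unfolding dual_space_def by auto
  then obtain c d where "\<forall>u\<in>V. cmod (\<psi> u) \<le> c * N u" "\<forall>u\<in>V. cmod (\<theta> u) \<le> d * N u"
    by blast
  then have "\<exists>C. \<forall>u\<in>V. cmod (\<psi> u + \<theta> u) \<le> C * N u"
    by (intro exI[of _ "c + d"] ballI) (simp add: distrib_right norm_triangle_mono)
  then show ?thesis
    using assms unfolding dual_space_def by (simp add: algebra_simps)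
qed

lemma dual_space_scale:
  assumes "\<psi> \<in> dual_space V N"
  shows "(\<lambda>u. c * \<psi> u) \<in> dual_space V N"
proof -
  have "\<exists>C. \<forall>u\<in>V. cmod (\<psi> u) \<le> C * N u"
    using assms unfolding dual_space_def by auto
  then obtain d where "\<forall>u\<in>V. cmod (\<psi> u) \<le> d * N u"
    by blast
  then have "\<exists>C. \<forall>u\<in>V. cmod (c * \<psi> u) \<le> C * N u"
    by (intro exI[of _ "cmod c * d"] ballI) (simp add: norm_mult mult_left_mono mult.assoc)
  then show ?thesis
    using assms unfolding dual_space_def by (simp add: algebra_simps)
qed

lemma dual_space_additive:
  "\<psi> \<in> dual_space V N \<Longrightarrow> u \<in> V \<Longrightarrow> v \<in> V \<Longrightarrow> \<psi> (\<lambda>x. u x + v x) = \<psi> u + \<psi> v"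
  by (simp add: dual_space_def)

lemma dual_space_homogeneous:
  "\<psi> \<in> dual_space V N \<Longrightarrow> u \<in> V \<Longrightarrow> \<psi> (\<lambda>x. c * u x) = c * \<psi> u"
  by (simp add: dual_space_def)

text \<open>Tychonoff's theorem in the product of the discs of radius \<open>R w\<close>. The
  conclusion is phrased through closed sets because equations and bounds between finitely many
  coordinates are closed conditions, and so pass to \<open>L\<close>.\<close>

lemma cluster_function:
  fixes e :: "'i \<Rightarrow> 'w \<Rightarrow> complex" and R :: "'w \<Rightarrow> real"
  assumes "P \<noteq> bot" and bound: "\<forall>\<^sub>F i in P. \<forall>w. cmod (e i w) \<le> R w"
  obtains L where "\<And>S. closed S \<Longrightarrow> \<forall>\<^sub>F i in P. e i \<in> S \<Longrightarrow> L \<in> S"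
proof -
  define K where "K = (\<Pi>\<^sub>E w\<in>UNIV. cball (0::complex) (R w))"
  have "compactin (product_topology (\<lambda>w. euclidean) UNIV) K"
    unfolding K_def by (subst compactin_PiE) auto
  then have "compact K"
    by (simp add: euclidean_product_topology)
  moreover have "\<forall>\<^sub>F f in filtermap e P. f \<in> K"
    using bound by (simp add: eventually_filtermap K_def PiE_def Pi_def)
  moreover have "filtermap e P \<noteq> bot"
    using \<open>P \<noteq> bot\<close> by (simp add: filtermap_bot_iff)
  ultimately obtain L where L: "inf (nhds L) (filtermap e P) \<noteq> bot"
    unfolding compact_filter by blast
  show thesis
  proof (rule that)
    fix S assume "closed S" and S: "\<forall>\<^sub>F i in P. e i \<in> S"
    show "L \<in> S"
    proof (rule ccontr)
      assume "L \<notin> S"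
      then have "\<forall>\<^sub>F f in nhds L. f \<notin> S"
        using \<open>closed S\<close> eventually_nhds_in_open[of "- S" L] by auto
      moreover have "\<forall>\<^sub>F f in filtermap e P. f \<in> S"
        using S by (simp add: eventually_filtermap)
      ultimately have "\<forall>\<^sub>F f in inf (nhds L) (filtermap e P). False"
        unfolding eventually_inf by blast
      then show False
        using L by (simp add: trivial_limit_def)
    qed
  qed
qed

text \<open>Each clause of \<open>dual_space\<close> is a closed condition on finitely many
  coordinates. The radius \<open>R\<close> is kept apart from \<open>N\<close> because every
  coordinate needs a disc, also those outside \<open>V\<close>, where the functionals vanish and
  nothing is known about \<open>N\<close>.\<close>

lemma cluster_functional:
  fixes e :: "'i \<Rightarrow> ('s \<Rightarrow> complex) \<Rightarrow> complex" and R :: "('s \<Rightarrow> complex) \<Rightarrow> real"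
  assumes "P \<noteq> bot" and bound: "\<forall>\<^sub>F i in P. \<forall>w. cmod (e i w) \<le> R w"
    and add: "\<And>u v. u \<in> V \<Longrightarrow> v \<in> V \<Longrightarrow> \<forall>\<^sub>F i in P. e i (\<lambda>x. u x + v x) = e i u + e i v"
    and scale: "\<And>c u. u \<in> V \<Longrightarrow> \<forall>\<^sub>F i in P. e i (\<lambda>x. c * u x) = c * e i u"
    and outside: "\<And>u. u \<notin> V \<Longrightarrow> \<forall>\<^sub>F i in P. e i u = 0"
    and norm: "\<And>u. u \<in> V \<Longrightarrow> R u \<le> N u"
  obtains L where "L \<in> dual_space V N"
    and "\<And>w C. closed C \<Longrightarrow> \<forall>\<^sub>F i in P. e i w \<in> C \<Longrightarrow> L w \<in> C"
proof -
  obtain L where L: "\<And>S. closed S \<Longrightarrow> \<forall>\<^sub>F i in P. e i \<in> S \<Longrightarrow> L \<in> S"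
    using cluster_function[OF \<open>P \<noteq> bot\<close> bound] by blast
  have coord: "continuous_on UNIV (\<lambda>f :: ('s \<Rightarrow> complex) \<Rightarrow> complex. f w)" for w
    by simp
  have eval: "L w \<in> C" if "closed C" "\<forall>\<^sub>F i in P. e i w \<in> C" for w C
    using L[OF closed_vimage[OF \<open>closed C\<close> coord]] that by simp
  have "L \<in> dual_space V N"
    unfolding dual_space_def mem_Collect_eq
  proof (intro conjI ballI allI impI)
    fix u v assume "u \<in> V" "v \<in> V"
    then show "L (\<lambda>x. u x + v x) = L u + L v"
      using L[of "{f. f (\<lambda>x. u x + v x) = f u + f v}"] add
      by (simp add: closed_Collect_eq continuous_intros coord)
  next
    fix c u assume "u \<in> V"
    then show "L (\<lambda>x. c * u x) = c * L u"
      using L[of "{f. f (\<lambda>x. c * u x) = c * f u}"] scale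
      by (simp add: closed_Collect_eq continuous_intros coord)
  next
    show "\<exists>C. \<forall>u\<in>V. cmod (L u) \<le> C * N u"
    proof (intro exI[of _ 1] ballI)
      fix u assume "u \<in> V"
      have "\<forall>\<^sub>F i in P. e i u \<in> cball 0 (R u)"
        using bound by eventually_elim simp
      then show "cmod (L u) \<le> 1 * N u"
        using eval[of "cball 0 (R u)" u] norm[OF \<open>u \<in> V\<close>] by simp
    qed
  next
    fix u assume "u \<notin> V"
    then show "L u = 0"
      using eval[of "{0}" u] outside by simp
  qed
  then show thesis
    using that eval by blast
qed

text \<open>
  The interchange of limits behind Grothendieck's double limit criterion: by reflexivity a cluster
  point in the bidual of the functions \<open>u\<^sub>X\<close> is itself a function \<open>w \<in> V\<close>, and a cluster point of
  the point evaluations along \<open>Q\<close> would have to send \<open>w\<close> into both \<open>C\<close> and \<open>D\<close>.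
\<close>

lemma not_reflexive_double_limit:
  fixes V :: "('s \<Rightarrow> complex) set" and N :: "('s \<Rightarrow> complex) \<Rightarrow> real"
  assumes add: "\<And>u v. u \<in> V \<Longrightarrow> v \<in> V \<Longrightarrow> (\<lambda>x. u x + v x) \<in> V"
    and scale: "\<And>c u. u \<in> V \<Longrightarrow> (\<lambda>x. c * u x) \<in> V"
    and eval: "\<And>u x. u \<in> V \<Longrightarrow> cmod (u x) \<le> N u"
    and "Q \<noteq> bot" and Y: "\<forall>\<^sub>F x in Q. x \<in> Y"
    and "closed C" "closed D" "C \<inter> D = {}"
    and approx: "\<And>X. finite X \<Longrightarrow> X \<subseteq> Y \<Longrightarrow>
      \<exists>u\<in>V. N u \<le> 1 \<and> (\<forall>x\<in>X. u x \<in> C) \<and> (\<forall>\<^sub>F x in Q. u x \<in> D)"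
  shows "\<not> reflexive_space V N"
proof
  assume refl: "reflexive_space V N"
  \<comment> \<open>Evaluation is cut off outside \<open>V\<close> to meet the convention that
    functionals vanish there; \<open>J\<close> below follows the same convention.\<close>
  define \<delta> where "\<delta> x u = (if u \<in> V then u x else 0)" for x u
  have \<delta>: "\<delta> x \<in> dual_space V N" for x
    using add scale eval unfolding dual_space_def \<delta>_def by (auto intro!: exI[of _ 1])
  obtain \<phi> where \<phi>: "\<phi> \<in> dual_space V N"
    "\<And>u B. closed B \<Longrightarrow> \<forall>\<^sub>F x in Q. \<delta> x u \<in> B \<Longrightarrow> \<phi> u \<in> B"
  proof (rule cluster_functional[where V = V and P = Q and e = \<delta> and R = "\<lambda>u. if u \<in> V then N u else 0"])
    show "\<forall>\<^sub>F x in Q. \<forall>u. cmod (\<delta> x u) \<le> (if u \<in> V then N u else 0)"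
      using eval by (simp add: \<delta>_def)
  qed (use \<open>Q \<noteq> bot\<close> add scale in \<open>auto simp: \<delta>_def\<close>)
  \<comment> \<open>Finite subsets ordered by inclusion: each point of \<open>Y\<close> eventually
    belongs to \<open>X\<close>, so \<open>U X\<close> eventually takes it into
    \<open>C\<close>.\<close>
  define P where "P = finite_subsets_at_top Y"
  have "\<forall>X. \<exists>u. finite X \<and> X \<subseteq> Y \<longrightarrow>
      u \<in> V \<and> N u \<le> 1 \<and> (\<forall>x\<in>X. u x \<in> C) \<and> (\<forall>\<^sub>F x in Q. u x \<in> D)"
    using approx by blast
  from choice[OF this] obtain U where U: "\<forall>X. finite X \<and> X \<subseteq> Y \<longrightarrow>
      U X \<in> V \<and> N (U X) \<le> 1 \<and> (\<forall>x\<in>X. U X x \<in> C) \<and> (\<forall>\<^sub>F x in Q. U X x \<in> D)"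
    by blast
  have P: "\<forall>\<^sub>F X in P. finite X \<and> X \<subseteq> Y \<and> x \<in> X" if "x \<in> Y" for x
    unfolding P_def eventually_finite_subsets_at_top using that by (intro exI[of _ "{x}"]) auto
  have P': "\<forall>\<^sub>F X in P. finite X \<and> X \<subseteq> Y"
    unfolding P_def eventually_finite_subsets_at_top by auto
  define W where "W = dual_space V N"
  define J where "J X \<psi> = (if \<psi> \<in> W then \<psi> (U X) else 0)" for X \<psi>
  obtain F where F: "F \<in> dual_space W (dual_norm V N)"
    "\<And>\<psi> B. closed B \<Longrightarrow> \<forall>\<^sub>F X in P. J X \<psi> \<in> B \<Longrightarrow> F \<psi> \<in> B"
  proof (rule cluster_functional[where V = W and P = P and e = J
        and R = "\<lambda>\<psi>. if \<psi> \<in> W then dual_norm V N \<psi> else 0"])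
    show "P \<noteq> bot"
      by (simp add: P_def)
    show "\<forall>\<^sub>F X in P. \<forall>\<psi>. cmod (J X \<psi>) \<le> (if \<psi> \<in> W then dual_norm V N \<psi> else 0)"
      using P'
    proof eventually_elim
      case (elim X)
      have "cmod (\<psi> (U X)) \<le> dual_norm V N \<psi>" if \<psi>: "\<psi> \<in> W" for \<psi>
        unfolding dual_norm_def
      proof (rule cSUP_upper)
        show "U X \<in> {u \<in> V. N u \<le> 1}"
          using U elim by simp
        have "\<exists>C. \<forall>u\<in>V. cmod (\<psi> u) \<le> C * N u"
          using \<psi> by (simp add: W_def dual_space_def)
        then obtain c where c: "\<And>u. u \<in> V \<Longrightarrow> cmod (\<psi> u) \<le> c * N u"
          by blast
        \<comment> \<open>\<open>dual_norm\<close> is a supremum of reals and bounds its members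
          only if they are bounded above. The absolute value is there because the constant in
          \<open>dual_space\<close> may be negative.\<close>
        have "cmod (\<psi> u) \<le> \<bar>c\<bar>" if "u \<in> V" "N u \<le> 1" for u
        proof -
          have "0 \<le> N u"
            by (rule order_trans[OF norm_ge_zero eval[OF \<open>u \<in> V\<close>]])
          then have "c * N u \<le> \<bar>c\<bar> * 1"
            using that by (intro mult_mono) auto
          then show ?thesis
            using c[OF \<open>u \<in> V\<close>] by simp
        qed
        then show "bdd_above ((\<lambda>u. cmod (\<psi> u)) ` {u \<in> V. N u \<le> 1})"
          by (intro bdd_aboveI[of _ "\<bar>c\<bar>"]) auto
      qed
      then show ?case
        by (simp add: J_def)
    qed
  next
    show "\<forall>\<^sub>F X in P. J X (\<lambda>u. \<psi> u + \<theta> u) = J X \<psi> + J X \<theta>"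
      if "\<psi> \<in> W" "\<theta> \<in> W" for \<psi> \<theta>
      using that dual_space_add[of \<psi> V N \<theta>] by (simp add: J_def W_def)
    show "\<forall>\<^sub>F X in P. J X (\<lambda>u. c * \<psi> u) = c * J X \<psi>" if "\<psi> \<in> W" for c \<psi>
      using that dual_space_scale[of \<psi> V N c] by (simp add: J_def W_def)
  qed (auto simp: J_def)
  obtain w where w: "w \<in> V" "\<And>\<psi>. \<psi> \<in> W \<Longrightarrow> F \<psi> = \<psi> w"
    using refl F(1) unfolding reflexive_space_def W_def by blast
  have wC: "w x \<in> C" if "x \<in> Y" for x
  proof -
    have "\<forall>\<^sub>F X in P. J X (\<delta> x) \<in> C"
      using P[OF that] by eventually_elim (use U \<delta> in \<open>auto simp: J_def W_def \<delta>_def\<close>)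
    then have "F (\<delta> x) \<in> C"
      using F(2) \<open>closed C\<close> by blast
    then show ?thesis
      using w \<delta>[of x] by (simp add: W_def \<delta>_def)
  qed
  \<comment> \<open>The two orders of the limits: \<open>\<phi> w\<close> takes \<open>X\<close>
    first and then \<open>Q\<close>, while \<open>F \<phi>\<close> takes \<open>Q\<close> first and
    then \<open>X\<close>. Since \<open>F\<close> is evaluation at \<open>w\<close>, they
    coincide.\<close>
  have "\<phi> w \<in> C"
    using Y wC w(1) by (intro \<phi>(2) \<open>closed C\<close>) (auto simp: \<delta>_def elim: eventually_mono)
  moreover have "F \<phi> \<in> D"
  proof (rule F(2)[OF \<open>closed D\<close>])
    show "\<forall>\<^sub>F X in P. J X \<phi> \<in> D"
      using P'
    proof eventually_elim
      case (elim X)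
      have "\<phi> (U X) \<in> D"
        by (rule \<phi>(2)[OF \<open>closed D\<close>]) (use U elim in \<open>simp add: \<delta>_def\<close>)
      then show ?case
        using \<phi>(1) by (simp add: J_def W_def)
    qed
  qed
  ultimately show False
    using w(2)[of \<phi>] \<phi>(1) \<open>C \<inter> D = {}\<close> by (auto simp: W_def)
qed

text \<open>The point evaluations, bounded by \<open>eval\<close>, span the dual of a
  finite-dimensional coordinate space. Hence \<open>F\<close> is determined by its values on them,
  and these values are the coordinates of the wanted vector.\<close>

lemma reflexive_space_finite:
  fixes N :: "('s \<Rightarrow> complex) \<Rightarrow> real"
  assumes fin: "finite (UNIV :: 's set)" and eval: "\<And>u x. cmod (u x) \<le> N u"
  shows "reflexive_space UNIV N"
  unfolding reflexive_space_def
proof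
  fix F assume F: "F \<in> dual_space (dual_space UNIV N) (dual_norm UNIV N)"
  define W where "W = dual_space UNIV N"
  define \<delta> where "\<delta> = (\<lambda>x (u :: 's \<Rightarrow> complex). u x)"
  have \<delta>: "\<delta> x \<in> W" for x
    using eval unfolding W_def dual_space_def \<delta>_def by (auto intro!: exI[of _ 1])
  note W_add = dual_space_add[of _ UNIV N, folded W_def]
  note W_scale = dual_space_scale[of _ UNIV N, folded W_def]
  note F_add = dual_space_additive[OF F, folded W_def]
  note F_scale = dual_space_homogeneous[OF F, folded W_def]
  have F_zero: "F (\<lambda>u. 0) = 0"
    using F_scale[OF \<delta>, of 0] by simp
  have W_zero: "(\<lambda>u. 0) \<in> W"
    using W_scale[OF \<delta>, of 0] by simp
  have comb: "(\<lambda>u. \<Sum>x\<in>X. a x * u x) \<in> W \<and> F (\<lambda>u. \<Sum>x\<in>X. a x * u x) = (\<Sum>x\<in>X. a x * F (\<delta> x))"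
    if "finite X" for X and a :: "'s \<Rightarrow> complex"
    using that
  proof induction
    case empty
    then show ?case
      by (simp add: F_zero W_zero)
  next
    case (insert y X)
    have 1: "(\<lambda>u. a y * u y) \<in> W" "F (\<lambda>u. a y * u y) = a y * F (\<delta> y)"
      using W_scale[OF \<delta>, of "a y" y] F_scale[OF \<delta>, of "a y" y] by (simp_all add: \<delta>_def)
    show ?case
      using insert 1 W_add[OF 1(1), of "\<lambda>u. \<Sum>x\<in>X. a x * u x"]
        F_add[OF 1(1), of "\<lambda>u. \<Sum>x\<in>X. a x * u x"] by simp
  qed
  show "\<exists>u\<in>UNIV. \<forall>\<phi>\<in>dual_space UNIV N. F \<phi> = \<phi> u"
  proof (intro bexI[of _ "\<lambda>x. F (\<delta> x)"] ballI)
    fix \<phi> assume "\<phi> \<in> dual_space UNIV N"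
    note add = dual_space_additive[OF this, simplified] and scale = dual_space_homogeneous[OF this, simplified]
    define b where "b y = \<phi> (\<lambda>x. of_bool (x = y))" for y
    have zero: "\<phi> (\<lambda>x. 0) = 0"
      using scale[of 0 "\<lambda>x. 0"] by simp
    have "\<phi> (\<lambda>x. \<Sum>y\<in>X. u y * d y x) = (\<Sum>y\<in>X. u y * \<phi> (d y))"
      if "finite X" for X u and d :: "'s \<Rightarrow> 's \<Rightarrow> complex"
      using that by induction (simp_all add: zero add scale)
    from this[OF fin, where d = "\<lambda>y x. of_bool (x = y)"]
    have "\<phi> (\<lambda>x. \<Sum>y\<in>UNIV. u y * of_bool (x = y)) = (\<Sum>y\<in>UNIV. b y * u y)" for u
      by (simp only: b_def mult.commute)
    moreover have "(\<lambda>x. \<Sum>y\<in>UNIV. u y * of_bool (x = y)) = u" for u :: "'s \<Rightarrow> complex"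
      using fin by simp
    ultimately have \<phi>: "\<phi> u = (\<Sum>y\<in>UNIV. b y * u y)" for u
      by metis
    have "F \<phi> = F (\<lambda>u. \<Sum>y\<in>UNIV. b y * u y)"
      by (intro arg_cong[where f = F] ext) (rule \<phi>)
    also have "\<dots> = \<phi> (\<lambda>x. F (\<delta> x))"
      using comb[OF fin, of b] \<phi>[of "\<lambda>x. F (\<delta> x)"] by argo
    finally show "F \<phi> = \<phi> (\<lambda>x. F (\<delta> x))" .
  qed simp
qed

section \<open>Foelner sets from invariant means\<close>

text \<open>
  Rado's argument: in a family that is minimal among those satisfying Hall's condition, every set
  is a singleton, by submodularity of the cardinality of unions. Minimal families are obtained as
  maximal sets \<open>T\<close> of removed incidences.
\<close>

lemma hall_infinite:
  fixes A :: "'i \<Rightarrow> 'b set"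
  assumes fin: "\<And>i. finite (A i)"
    and hall: "\<And>J. finite J \<Longrightarrow> card J \<le> card (\<Union>i\<in>J. A i)"
  obtains f where "inj f" "\<And>i. f i \<in> A i"
proof -
  define rest where "rest T i = {b \<in> A i. (i, b) \<notin> T}" for T i
  define \<T> where "\<T> = {T. \<forall>J. finite J \<longrightarrow> card J \<le> card (\<Union>i\<in>J. rest T i)}"
  have "\<exists>M\<in>\<T>. \<forall>X\<in>\<T>. M \<subseteq> X \<longrightarrow> X = M"
  proof (rule subset_Zorn_nonempty)
    have "{} \<in> \<T>"
      using hall by (simp add: \<T>_def rest_def)
    then show "\<T> \<noteq> {}"
      by blast
  next
    fix \<C> assume "\<C> \<noteq> {}" and chain: "subset.chain \<T> \<C>"
    show "\<Union>\<C> \<in> \<T>"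
      unfolding \<T>_def
    proof (intro CollectI allI impI)
      \<comment> \<open>Only finitely many incidences concern \<open>J\<close>, so a single member
        of the chain already removes all those that the union removes.\<close>
      fix J :: "'i set" assume "finite J"
      then have "finite (Sigma J A \<inter> \<Union>\<C>)"
        using fin by auto
      then obtain T where T: "T \<in> \<C>" "Sigma J A \<inter> \<Union>\<C> \<subseteq> T"
        by (rule finite_subset_Union_chain[OF _ _ \<open>\<C> \<noteq> {}\<close> chain]) auto
      then have "(\<Union>i\<in>J. rest (\<Union>\<C>) i) = (\<Union>i\<in>J. rest T i)"
        unfolding rest_def by blast
      moreover have "T \<in> \<T>"
        using T(1) chain by (auto simp: subset.chain_def)
      ultimately show "card J \<le> card (\<Union>i\<in>J. rest (\<Union>\<C>) i)"
        using \<open>finite J\<close> by (simp add: \<T>_def)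
    qed
  qed
  then obtain M where "M \<in> \<T>" and max: "\<And>X. X \<in> \<T> \<Longrightarrow> M \<subseteq> X \<Longrightarrow> X = M"
    by blast
  define B where "B = rest M"
  have finB: "finite (B i)" for i
    using fin by (simp add: B_def rest_def)
  have hallB: "card J \<le> card (\<Union>i\<in>J. B i)" if "finite J" for J
    using \<open>M \<in> \<T>\<close> that by (simp add: \<T>_def B_def)
  \<comment> \<open>By maximality of \<open>M\<close>, deleting \<open>b\<close> from
    \<open>B i\<close> breaks Hall's condition at some \<open>J\<close>. This \<open>J\<close> must
    contain \<open>i\<close>, and \<open>K\<close> is the rest of it.\<close>
  have critical: "\<exists>K. finite K \<and> i \<notin> K \<and> card ((\<Union>j\<in>K. B j) \<union> (B i - {b})) \<le> card K"
    if "b \<in> B i" for i b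
  proof -
    have "(i, b) \<notin> M"
      using that by (simp add: B_def rest_def)
    then have "insert (i, b) M \<notin> \<T>"
      using max by blast
    then obtain J where J: "finite J" "card (\<Union>j\<in>J. rest (insert (i, b) M) j) < card J"
      unfolding \<T>_def by (auto simp: not_le)
    have "i \<in> J"
    proof (rule ccontr)
      assume "i \<notin> J"
      then have "(\<Union>j\<in>J. rest (insert (i, b) M) j) = (\<Union>j\<in>J. B j)"
        unfolding rest_def B_def by blast
      then show False
        using J hallB[of J] by simp
    qed
    have "(\<Union>j\<in>J. rest (insert (i, b) M) j) = (\<Union>j\<in>J - {i}. B j) \<union> (B i - {b})"
      using \<open>i \<in> J\<close> unfolding rest_def B_def by auto
    then show ?thesis
      using J \<open>i \<in> J\<close> by (intro exI[of _ "J - {i}"]) auto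
  qed
  have single: "b = c" if bc: "b \<in> B i" "c \<in> B i" for i b c
  proof (rule ccontr)
    assume "b \<noteq> c"
    obtain K where K: "finite K" "i \<notin> K" "card ((\<Union>j\<in>K. B j) \<union> (B i - {b})) \<le> card K"
      using critical[OF bc(1)] by blast
    obtain L where L: "finite L" "i \<notin> L" "card ((\<Union>j\<in>L. B j) \<union> (B i - {c})) \<le> card L"
      using critical[OF bc(2)] by blast
    \<comment> \<open>Since \<open>b\<close> and \<open>c\<close> differ, \<open>X\<close> and
      \<open>Y\<close> together contain all of \<open>B i\<close>. So their union has at least |K
      \<union> L| + 1 elements and their intersection at least |K \<inter> L|; adding gives |X| +
      |Y| > |K| + |L|, against the choice of \<open>K\<close> and \<open>L\<close>.\<close>
    define X where "X = (\<Union>j\<in>K. B j) \<union> (B i - {b})"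
    define Y where "Y = (\<Union>j\<in>L. B j) \<union> (B i - {c})"
    have finXY: "finite X" "finite Y"
      using K(1) L(1) finB by (auto simp: X_def Y_def)
    have "card (insert i (K \<union> L)) \<le> card (\<Union>j\<in>insert i (K \<union> L). B j)"
      using K(1) L(1) by (intro hallB) auto
    also have "\<dots> \<le> card (X \<union> Y)"
      using finXY \<open>b \<noteq> c\<close> by (intro card_mono) (auto simp: X_def Y_def)
    finally have 1: "card (K \<union> L) + 1 \<le> card (X \<union> Y)"
      using K L by simp
    have "card (K \<inter> L) \<le> card (\<Union>j\<in>K \<inter> L. B j)"
      using K(1) by (intro hallB) auto
    also have "\<dots> \<le> card (X \<inter> Y)"
      using finXY by (intro card_mono) (auto simp: X_def Y_def)
    finally show False
      using 1 K(3) L(3) card_Un_Int[OF finXY] card_Un_Int[OF K(1) L(1)]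
      unfolding X_def[symmetric] Y_def[symmetric] by linarith
  qed
  have "B i \<noteq> {}" for i
    using hallB[of "{i}"] by auto
  then have "\<exists>b. B i = {b}" for i
    using single by blast
  then obtain f where f: "\<And>i. B i = {f i}"
    by metis
  show thesis
  proof (rule that)
    show "inj f"
    proof (rule injI, rule ccontr)
      fix i j assume "f i = f j" "i \<noteq> j"
      then show False
        using hallB[of "{i, j}"] f by simp
    qed
    show "f i \<in> A i" for i
      using f[of i] by (auto simp: B_def rest_def)
  qed
qed

text \<open>
  If the conclusion failed, translates of a finite set by \<open>S + S\<close> would at least double
  (\<open>9/4 \<ge> 2\<close>), and Hall's theorem would produce a paradoxical decomposition.
\<close>

lemma foelner_set_exists:
  fixes m :: "('a::group_add \<Rightarrow> real) \<Rightarrow> real" and S :: "'a set"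
  assumes add: "\<And>f g. bounded (range f) \<Longrightarrow> bounded (range g) \<Longrightarrow> m (\<lambda>x. f x + g x) = m f + m g"
    and nonneg: "\<And>f. bounded (range f) \<Longrightarrow> (\<And>x. 0 \<le> f x) \<Longrightarrow> 0 \<le> m f"
    and one: "m (\<lambda>_. 1) = 1"
    and inv: "\<And>a f. bounded (range f) \<Longrightarrow> m (\<lambda>x. f (a + x)) = m f"
    and "finite S"
  shows "\<exists>E. finite E \<and> E \<noteq> {} \<and> 2 * card (\<Union>s\<in>S. (+) s ` E) < 3 * card E"
proof (rule ccontr)
  assume neg: "\<not> ?thesis"
  have growth: "3 * card E \<le> 2 * card (\<Union>s\<in>S. (+) s ` E)" if "finite E" for E :: "'a set"
    using neg that by (cases "E = {}") (auto simp: not_less)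
  define S2 where "S2 = (\<lambda>(s, t). s + t) ` (S \<times> S)"
  have "finite S2"
    using \<open>finite S\<close> by (simp add: S2_def)
  \<comment> \<open>Two copies of the group are injected into one, each point being moved by left
    addition of an element of the finite set \<open>S2\<close>.\<close>
  obtain f :: "'a \<times> bool \<Rightarrow> 'a" where "inj f" and f: "\<And>p. f p \<in> (\<lambda>s. s + fst p) ` S2"
  proof (rule hall_infinite[where A = "\<lambda>p :: 'a \<times> bool. (\<lambda>s. s + fst p) ` S2"])
    show "finite ((\<lambda>s. s + fst p) ` S2)" for p :: "'a \<times> bool"
      using \<open>finite S2\<close> by simp
  next
    fix J :: "('a \<times> bool) set" assume "finite J"
    define E where "E = fst ` J"
    have "finite E"
      using \<open>finite J\<close> by (simp add: E_def)
    have "J \<subseteq> E \<times> UNIV"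
      by (force simp: E_def)
    then have "card J \<le> card (E \<times> (UNIV :: bool set))"
      using \<open>finite E\<close> by (intro card_mono) auto
    moreover have "(\<Union>p\<in>J. (\<lambda>s. s + fst p) ` S2) = (\<Union>s\<in>S. (+) s ` (\<Union>t\<in>S. (+) t ` E))"
      by (force simp: S2_def E_def add.assoc image_iff)
    moreover have "3 * card (\<Union>t\<in>S. (+) t ` E) \<le> 2 * card (\<Union>s\<in>S. (+) s ` (\<Union>t\<in>S. (+) t ` E))"
      using \<open>finite S\<close> \<open>finite E\<close> by (intro growth) auto
    ultimately show "card J \<le> card (\<Union>p\<in>J. (\<lambda>s. s + fst p) ` S2)"
      using growth[OF \<open>finite E\<close>] by (simp add: card_cartesian_product)
  qed blast
  \<comment> \<open>The mean restricted to indicator functions: a finitely additive, left-invariant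
    probability on all subsets.\<close>
  define \<nu> where "\<nu> A = m (\<lambda>x. of_bool (x \<in> A))" for A :: "'a set"
  have bdd: "bounded (range (\<lambda>x. of_bool (P x) :: real))" for P :: "'a \<Rightarrow> bool"
    by (rule boundedI[where B = 1]) auto
  have \<nu>_Un: "\<nu> (A \<union> B) = \<nu> A + \<nu> B" if "A \<inter> B = {}" for A B
  proof -
    have "(\<lambda>x. of_bool (x \<in> A \<union> B) :: real) = (\<lambda>x. of_bool (x \<in> A) + of_bool (x \<in> B))"
      using that by (auto simp: fun_eq_iff)
    then show ?thesis
      using add[OF bdd bdd] by (simp add: \<nu>_def)
  qed
  have \<nu>_nonneg: "0 \<le> \<nu> A" for A
    unfolding \<nu>_def by (rule nonneg[OF bdd]) simp
  have \<nu>_UNIV: "\<nu> UNIV = 1"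
    using one by (simp add: \<nu>_def)
  have \<nu>_le_1: "\<nu> A \<le> 1" for A
    using \<nu>_Un[of A "- A"] \<nu>_nonneg[of "- A"] \<nu>_UNIV by simp
  have \<nu>_translate: "\<nu> ((+) s ` A) = \<nu> A" for s A
  proof -
    have "x \<in> (+) s ` A \<longleftrightarrow> - s + x \<in> A" for x
      by (metis add_minus_cancel image_iff minus_add_cancel)
    then show ?thesis
      using inv[OF bdd, where P1 = "\<lambda>x. x \<in> A" and a = "- s"] by (simp add: \<nu>_def)
  qed
  have \<nu>_empty: "\<nu> {} = 0"
    using \<nu>_Un[of "{}" "{}"] by simp
  have \<nu>_UN: "\<nu> (\<Union>k\<in>K. A k) = (\<Sum>k\<in>K. \<nu> (A k))"
    if "finite K" "disjoint_family_on A K" for K :: "'k set" and A :: "'k \<Rightarrow> 'a set"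
    using that
  proof induction
    case empty
    then show ?case
      by (simp add: \<nu>_empty)
  next
    case (insert k K)
    then have "A k \<inter> (\<Union>k\<in>K. A k) = {}" "disjoint_family_on A K"
      by (auto simp: disjoint_family_on_def)
    then show ?case
      using insert \<nu>_Un by simp
  qed
  \<comment> \<open>The points of copy \<open>i\<close> that \<open>f\<close> moves by
    \<open>s\<close>. For fixed \<open>i\<close> these pieces partition the group, and by
    injectivity of \<open>f\<close> the moved pieces are disjoint over all \<open>i\<close> and
    \<open>s\<close>; so the group would contain mass 2.\<close>
  define P where "P i s = {y. f (y, i) = s + y}" for i s
  have "(\<Sum>s\<in>S2. \<nu> (P i s)) = 1" for i
  proof -
    have "(\<Union>s\<in>S2. P i s) = UNIV"
      using f by (fastforce simp: P_def)
    moreover have "disjoint_family_on (P i) S2"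
      by (auto simp: disjoint_family_on_def P_def)
    ultimately show ?thesis
      using \<nu>_UN[OF \<open>finite S2\<close>, of "P i"] \<nu>_UNIV by simp
  qed
  then have "2 = (\<Sum>i\<in>(UNIV :: bool set). \<Sum>s\<in>S2. \<nu> (P i s))"
    by simp
  also have "\<dots> = (\<Sum>p\<in>UNIV \<times> S2. \<nu> ((+) (snd p) ` P (fst p) (snd p)))"
    by (simp add: \<nu>_translate sum.cartesian_product case_prod_unfold)
  also have "\<dots> = \<nu> (\<Union>p\<in>UNIV \<times> S2. (+) (snd p) ` P (fst p) (snd p))"
  proof (rule \<nu>_UN[symmetric])
    show "finite ((UNIV :: bool set) \<times> S2)"
      using \<open>finite S2\<close> by simp
    show "disjoint_family_on (\<lambda>p. (+) (snd p) ` P (fst p) (snd p)) (UNIV \<times> S2)"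
      unfolding disjoint_family_on_def
    proof (intro ballI impI)
      fix p q :: "bool \<times> 'a" assume "p \<noteq> q"
      show "(+) (snd p) ` P (fst p) (snd p) \<inter> (+) (snd q) ` P (fst q) (snd q) = {}"
      proof (rule ccontr)
        assume "\<not> ?thesis"
        then obtain y z where yz: "y \<in> P (fst p) (snd p)" "z \<in> P (fst q) (snd q)"
          "snd p + y = snd q + z"
          by blast
        then have "f (y, fst p) = f (z, fst q)"
          by (simp add: P_def)
        then have "y = z" "fst p = fst q"
          using injD[OF \<open>inj f\<close>] by auto
        then show False
          using yz(3) \<open>p \<noteq> q\<close> by (simp add: prod_eq_iff)
      qed
    qed
  qed
  also have "\<dots> \<le> 1"
    by (rule \<nu>_le_1)
  finally show False
    by simp
qed

section \<open>Norm estimates in Orlicz spaces and their algebra\<close>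

lemma finite_young_function:
  assumes "young_function \<Phi>" and fin: "\<forall>x. \<Phi> x \<noteq> \<infinity>"
  obtains \<phi> :: "real \<Rightarrow> real" where "\<Phi> = (\<lambda>x. ereal (\<phi> x))" "\<And>x. 0 \<le> \<phi> x" "\<phi> 0 = 0"
    "convex_on UNIV \<phi>" "filterlim \<phi> at_top at_top"
proof -
  define \<phi> where "\<phi> x = real_of_ereal (\<Phi> x)" for x
  have nonneg: "0 \<le> \<Phi> x" for x
    using assms by (simp add: young_function_def)
  have \<Phi>: "\<Phi> x = ereal (\<phi> x)" for x
    using fin nonneg[of x] by (cases "\<Phi> x") (auto simp: \<phi>_def)
  then have "\<Phi> = (\<lambda>x. ereal (\<phi> x))"
    by blast
  show thesis
  proof (rule that)
    show "\<Phi> = (\<lambda>x. ereal (\<phi> x))"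
      by fact
    show "0 \<le> \<phi> x" for x
      using nonneg[of x] by (simp add: \<Phi>)
    show "\<phi> 0 = 0"
      using assms by (simp add: young_function_def \<phi>_def)
    show "convex_on UNIV \<phi>"
    proof (rule convex_onI)
      fix t x y :: real assume t: "0 < t" "t < 1"
      have "\<Phi> ((1 - t) * x + t * y) \<le> ereal (1 - t) * \<Phi> x + ereal t * \<Phi> y"
        using assms t by (simp add: young_function_def)
      then show "\<phi> ((1 - t) *\<^sub>R x + t *\<^sub>R y) \<le> (1 - t) * \<phi> x + t * \<phi> y"
        by (simp add: \<Phi>)
    qed simp
    have "(\<Phi> \<longlongrightarrow> \<infinity>) at_top"
      using assms by (simp add: young_function_def)
    then show "filterlim \<phi> at_top at_top"
      unfolding \<open>\<Phi> = (\<lambda>x. ereal (\<phi> x))\<close> tendsto_PInfty_eq_at_top .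
  qed
qed

section \<open>Interleaved series and bounds for sums\<close>

lemma tendsto_even_odd:
  fixes X :: "nat \<Rightarrow> 'b::topological_space"
  assumes "(\<lambda>n. X (2 * n)) \<longlonglongrightarrow> l" "(\<lambda>n. X (2 * n + 1)) \<longlonglongrightarrow> l"
  shows "X \<longlonglongrightarrow> l"
proof (rule topological_tendstoI)
  fix S assume "open S" "l \<in> S"
  then have "\<forall>\<^sub>F n in sequentially. X (2 * n) \<in> S \<and> X (2 * n + 1) \<in> S"
    using assms by (intro eventually_conj topological_tendstoD)
  then obtain N where N: "\<And>n. n \<ge> N \<Longrightarrow> X (2 * n) \<in> S \<and> X (2 * n + 1) \<in> S"
    unfolding eventually_sequentially by blast
  have "X n \<in> S" if "n \<ge> 2 * N" for n
    using N[of "n div 2"] that by (cases "even n") (auto elim!: evenE oddE)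
  then show "\<forall>\<^sub>F n in sequentially. X n \<in> S"
    unfolding eventually_sequentially by blast
qed

text \<open>Plain convergence suffices, without rearrangement: 2n terms give the sum of the two n-th
  partial sums, and one further term only advances the first. The type class covers complex values
  as well as costs in \<open>ennreal\<close>.\<close>

lemma sums_interleave:
  fixes f g :: "nat \<Rightarrow> 'b::{topological_comm_monoid_add, t2_space}"
  assumes "f sums a" "g sums b"
  shows "(\<lambda>n. if even n then f (n div 2) else g (n div 2)) sums (a + b)"
proof -
  define h where "h n = (if even n then f (n div 2) else g (n div 2))" for n
  have even: "sum h {..<2 * n} = sum f {..<n} + sum g {..<n}" for n
    by (induction n) (simp_all add: h_def algebra_simps)
  have odd: "sum h {..<2 * n + 1} = sum f {..<Suc n} + sum g {..<n}" for n
    using even[of n] by (simp add: h_def algebra_simps)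
  have fg: "(\<lambda>n. sum f {..<n}) \<longlonglongrightarrow> a" "(\<lambda>n. sum g {..<n}) \<longlonglongrightarrow> b"
    using assms by (simp_all add: sums_def)
  have "(\<lambda>n. sum h {..<2 * n}) \<longlonglongrightarrow> a + b"
    unfolding even by (intro tendsto_add fg)
  moreover have "(\<lambda>n. sum h {..<2 * n + 1}) \<longlonglongrightarrow> a + b"
    unfolding odd by (intro tendsto_add fg LIMSEQ_Suc)
  ultimately have "(\<lambda>n. sum h {..<n}) \<longlonglongrightarrow> a + b"
    by (rule tendsto_even_odd)
  then show ?thesis
    by (simp add: sums_def h_def)
qed

lemma norm_sums_le:
  assumes "c sums s" "\<And>n. ennreal (norm (c n)) \<le> d n"
  shows "ennreal (norm s) \<le> (\<Sum>n. d n)"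
proof (rule LIMSEQ_le_const2)
  show "(\<lambda>n. ennreal (norm (sum c {..<n}))) \<longlonglongrightarrow> ennreal (norm s)"
    using assms(1) by (intro tendsto_ennrealI tendsto_norm) (simp add: sums_def)
  have "ennreal (norm (sum c {..<n})) \<le> (\<Sum>n. d n)" for n
  proof -
    have "ennreal (norm (sum c {..<n})) \<le> ennreal (\<Sum>i<n. norm (c i))"
      by (intro ennreal_leI norm_sum)
    also have "\<dots> = (\<Sum>i<n. ennreal (norm (c i)))"
      by simp
    also have "\<dots> \<le> (\<Sum>i<n. d i)"
      by (intro sum_mono assms)
    also have "\<dots> \<le> (\<Sum>n. d n)"
      by (intro sum_le_suminf) auto
    finally show ?thesis .
  qed
  then show "\<exists>N. \<forall>n\<ge>N. ennreal (norm (sum c {..<n})) \<le> (\<Sum>n. d n)"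
    by blast
qed

text \<open>The \<Delta>2-condition makes both Young functions finite, so they enter as real convex
  functions, which are continuous. Complementarity enters as Young's inequality.\<close>

locale orlicz_haar =
  fixes \<mu> :: "'a::{topological_group_add, t2_space} measure" and \<phi> \<psi> :: "real \<Rightarrow> real"
  assumes haar: "left_haar_measure \<mu>"
    and \<phi>_nonneg: "0 \<le> \<phi> x" and \<phi>_zero: "\<phi> 0 = 0" and \<phi>_convex: "convex_on UNIV \<phi>"
    and \<phi>_at_top: "filterlim \<phi> at_top at_top"
    and \<psi>_nonneg: "0 \<le> \<psi> x" and \<psi>_zero: "\<psi> 0 = 0" and \<psi>_convex: "convex_on UNIV \<psi>"
    and young: "0 \<le> x \<Longrightarrow> 0 \<le> y \<Longrightarrow> x * y \<le> \<phi> x + \<psi> y"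
begin

abbreviation \<Phi> :: "real \<Rightarrow> ereal" where "\<Phi> \<equiv> \<lambda>x. ereal (\<phi> x)"
abbreviation \<Psi> :: "real \<Rightarrow> ereal" where "\<Psi> \<equiv> \<lambda>x. ereal (\<psi> x)"

lemma sets_\<mu> [measurable_cong, simp]: "sets \<mu> = sets borel"
  using haar by (simp add: left_haar_measure_def)

lemma space_\<mu> [simp]: "space \<mu> = UNIV"
  using sets_eq_imp_space_eq[OF sets_\<mu>] by simp

lemma \<phi>_measurable [measurable]: "\<phi> \<in> borel_measurable borel"
  and \<psi>_measurable [measurable]: "\<psi> \<in> borel_measurable borel"
  by (auto intro!: borel_measurable_continuous_onI convex_on_continuous \<phi>_convex \<psi>_convex)

lemma emeasure_translate: "A \<in> sets borel \<Longrightarrow> emeasure \<mu> ((+) a ` A) = emeasure \<mu> A"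
  using haar by (simp add: left_haar_measure_def)

lemma measurable_translate [measurable]: "(\<lambda>x. a + x) \<in> borel \<rightarrow>\<^sub>M (borel :: 'a measure)"
  by (intro borel_measurable_continuous_onI continuous_intros)

lemma distr_translate: "distr \<mu> borel ((+) a) = \<mu>"
proof (rule measure_eqI)
  fix A assume "A \<in> sets (distr \<mu> borel ((+) a))"
  then have A: "A \<in> sets borel"
    by simp
  have "(+) a -` A = (+) (- a) ` A"
    by (force simp: add.assoc[symmetric] image_iff)
  then show "emeasure (distr \<mu> borel ((+) a)) A = emeasure \<mu> A"
    using A by (subst emeasure_distr) (auto simp: emeasure_translate)
qed simp

lemma nn_integral_translate:
  assumes "f \<in> borel_measurable borel"
  shows "(\<integral>\<^sup>+ x. f (a + x) \<partial>\<mu>) = (\<integral>\<^sup>+ x. f x \<partial>\<mu>)"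
  using assms nn_integral_distr[of "(+) a" \<mu> borel f] by (simp add: distr_translate)

section \<open>Luxemburg norm, Orlicz norm and Hoelder's inequality\<close>

lemma orlicz_modular_eq:
  "orlicz_modular \<mu> (\<lambda>x. ereal (\<theta> x)) f = (\<integral>\<^sup>+ x. ennreal (\<theta> (cmod (f x))) \<partial>\<mu>)"
  by (simp add: orlicz_modular_def)

lemma convex_scale_le:
  assumes "convex_on UNIV \<theta>" "\<theta> 0 = (0::real)" "0 \<le> t" "t \<le> 1"
  shows "\<theta> (t * x) \<le> t * \<theta> x"
  using convex_onD[OF assms(1), of t 0 x] assms by simp

lemma luxemburg_norm_le:
  "0 < k \<Longrightarrow> orlicz_modular \<mu> \<Phi> (\<lambda>x. f x / of_real k) \<le> 1 \<Longrightarrow> luxemburg_norm \<mu> \<Phi> f \<le> ennreal k"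
  unfolding luxemburg_norm_def by (rule INF_lower) simp

text \<open>Convexity and \<open>\<phi> 0 = 0\<close> make the modular shrink at least linearly
  under scaling, so a finite modular can be brought below 1. The infimum defining the Luxemburg norm
  is thus not over the empty set, where it would be infinite.\<close>

lemma orlicz_space_admissible:
  assumes "f \<in> orlicz_space \<mu> \<Phi>"
  obtains k where "0 < k" "orlicz_modular \<mu> \<Phi> (\<lambda>x. f x / of_real k) \<le> 1"
proof -
  have [measurable]: "f \<in> borel_measurable borel"
    using assms measurable_cong_sets[OF sets_\<mu> refl] by (auto simp: orlicz_space_def)
  obtain \<beta> where \<beta>: "0 < \<beta>" "orlicz_modular \<mu> \<Phi> (\<lambda>x. of_real \<beta> * f x) < \<infinity>"
    using assms by (auto simp: orlicz_space_def)
  then obtain c where c: "orlicz_modular \<mu> \<Phi> (\<lambda>x. of_real \<beta> * f x) = ennreal c" "0 \<le> c"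
    by (cases "orlicz_modular \<mu> \<Phi> (\<lambda>x. of_real \<beta> * f x)") auto
  \<comment> \<open>At most 1 for convexity to apply, and small enough to bring the modular
    \<open>c\<close> down to 1.\<close>
  define t where "t = 1 / max 1 c"
  have t: "0 < t" "t \<le> 1" "t * c \<le> 1"
    using c by (auto simp: t_def field_simps max_def)
  define k where "k = 1 / (t * \<beta>)"
  have "0 < k"
    using t \<beta> by (simp add: k_def)
  have "orlicz_modular \<mu> \<Phi> (\<lambda>x. f x / of_real k) = (\<integral>\<^sup>+ x. ennreal (\<phi> (t * cmod (\<beta> * f x))) \<partial>\<mu>)"
    using t \<beta> by (simp add: orlicz_modular_eq k_def norm_mult norm_divide mult_ac)
  also have "\<dots> \<le> (\<integral>\<^sup>+ x. ennreal t * ennreal (\<phi> (cmod (\<beta> * f x))) \<partial>\<mu>)"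
    using t \<phi>_nonneg convex_scale_le[OF \<phi>_convex \<phi>_zero, of t]
    by (intro nn_integral_mono) (simp add: ennreal_mult[symmetric] ennreal_leI)
  also have "\<dots> = ennreal t * orlicz_modular \<mu> \<Phi> (\<lambda>x. of_real \<beta> * f x)"
    by (simp add: nn_integral_cmult orlicz_modular_eq)
  also have "\<dots> \<le> 1"
    using t c by (simp add: ennreal_mult[symmetric])
  finally show thesis
    using that \<open>0 < k\<close> by blast
qed

lemma luxemburg_norm_finite: "f \<in> orlicz_space \<mu> \<Phi> \<Longrightarrow> luxemburg_norm \<mu> \<Phi> f < \<infinity>"
  using orlicz_space_admissible luxemburg_norm_le ennreal_less_top infinity_ennreal_def order_le_less_trans
  by metis

text \<open>Young's inequality for |h| and \<beta>|g|, divided by \<beta>, bounds every competitor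
  \<open>h\<close> at once.\<close>

lemma orlicz_norm_finite:
  assumes "g \<in> orlicz_space \<mu> \<Psi>"
  shows "orlicz_norm \<mu> \<Phi> g < \<infinity>"
proof -
  have [measurable]: "g \<in> borel_measurable borel"
    using assms measurable_cong_sets[OF sets_\<mu> refl] by (auto simp: orlicz_space_def)
  obtain \<beta> where \<beta>: "0 < \<beta>" "orlicz_modular \<mu> \<Psi> (\<lambda>x. of_real \<beta> * g x) < \<infinity>"
    using assms by (auto simp: orlicz_space_def)
  define c where "c = orlicz_modular \<mu> \<Psi> (\<lambda>x. of_real \<beta> * g x)"
  have "orlicz_norm \<mu> \<Phi> g \<le> ennreal (1 / \<beta>) * (1 + c)"
    unfolding orlicz_norm_def
  proof (rule SUP_least)
    fix h assume h: "h \<in> {h \<in> orlicz_space \<mu> \<Phi>. orlicz_modular \<mu> \<Phi> h \<le> 1}"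
    then have [measurable]: "h \<in> borel_measurable borel"
      using measurable_cong_sets[OF sets_\<mu> refl] by (auto simp: orlicz_space_def)
    have "(\<integral>\<^sup>+ x. ennreal (cmod (g x * h x)) \<partial>\<mu>)
        \<le> (\<integral>\<^sup>+ x. ennreal (1 / \<beta>) * (ennreal (\<phi> (cmod (h x))) + ennreal (\<psi> (cmod (\<beta> * g x)))) \<partial>\<mu>)"
    proof (intro nn_integral_mono)
      fix x
      have "cmod (h x) * cmod (\<beta> * g x) \<le> \<phi> (cmod (h x)) + \<psi> (cmod (\<beta> * g x))"
        by (rule young) auto
      then have "cmod (g x * h x) \<le> 1 / \<beta> * (\<phi> (cmod (h x)) + \<psi> (cmod (\<beta> * g x)))"
        using \<beta> by (simp add: norm_mult field_simps)
      then show "ennreal (cmod (g x * h x))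
          \<le> ennreal (1 / \<beta>) * (ennreal (\<phi> (cmod (h x))) + ennreal (\<psi> (cmod (\<beta> * g x))))"
        using \<beta> \<phi>_nonneg \<psi>_nonneg by (simp add: ennreal_mult[symmetric] ennreal_plus[symmetric] ennreal_leI del: ennreal_plus)
    qed
    also have "\<dots> = ennreal (1 / \<beta>) * (orlicz_modular \<mu> \<Phi> h + c)"
      by (simp add: nn_integral_cmult nn_integral_add orlicz_modular_eq c_def)
    also have "\<dots> \<le> ennreal (1 / \<beta>) * (1 + c)"
      using h by (intro mult_left_mono add_mono) auto
    finally show "(\<integral>\<^sup>+ x. ennreal (cmod (g x * h x)) \<partial>\<mu>) \<le> ennreal (1 / \<beta>) * (1 + c)" .
  qed
  also have "\<dots> < \<infinity>"
    using \<beta> by (auto simp: c_def ennreal_mult_less_top)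
  finally show ?thesis .
qed

text \<open>For admissible \<open>k\<close> the quotient \<open>f / k\<close> competes in the
  supremum defining the Orlicz norm of \<open>g\<close>; then the infimum over \<open>k\<close> is
  taken.\<close>

lemma hoelder:
  assumes f: "f \<in> orlicz_space \<mu> \<Phi>" and g: "g \<in> orlicz_space \<mu> \<Psi>"
  shows "(\<integral>\<^sup>+ x. ennreal (cmod (f x * g x)) \<partial>\<mu>) \<le> luxemburg_norm \<mu> \<Phi> f * orlicz_norm \<mu> \<Phi> g"
    (is "?I \<le> _")
proof -
  have [measurable]: "f \<in> borel_measurable borel" "g \<in> borel_measurable borel"
    using assms measurable_cong_sets[OF sets_\<mu> refl] by (auto simp: orlicz_space_def)
  have bound: "?I \<le> ennreal k * orlicz_norm \<mu> \<Phi> g"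
    if k: "0 < k" "orlicz_modular \<mu> \<Phi> (\<lambda>x. f x / of_real k) \<le> 1" for k
  proof -
    define h where "h x = f x / of_real k" for x
    have "h \<in> orlicz_space \<mu> \<Phi>"
      unfolding orlicz_space_def
    proof (intro CollectI conjI exI[of _ 1])
      show "h \<in> borel_measurable \<mu>"
        unfolding h_def by measurable
      show "orlicz_modular \<mu> \<Phi> (\<lambda>x. of_real 1 * h x) < \<infinity>"
        using k(2) by (simp add: h_def order_le_less_trans[OF _ ennreal_one_less_top])
    qed simp
    moreover have "orlicz_modular \<mu> \<Phi> h \<le> 1"
      using k(2) by (simp add: h_def[abs_def])
    ultimately have "(\<integral>\<^sup>+ x. ennreal (cmod (g x * h x)) \<partial>\<mu>) \<le> orlicz_norm \<mu> \<Phi> g"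
      unfolding orlicz_norm_def by (intro SUP_upper) simp
    then have "ennreal k * (\<integral>\<^sup>+ x. ennreal (cmod (g x * h x)) \<partial>\<mu>) \<le> ennreal k * orlicz_norm \<mu> \<Phi> g"
      by (rule mult_left_mono) simp
    moreover have "ennreal k * (\<integral>\<^sup>+ x. ennreal (cmod (g x * h x)) \<partial>\<mu>)
        = (\<integral>\<^sup>+ x. ennreal k * ennreal (cmod (g x * h x)) \<partial>\<mu>)"
      by (simp add: h_def nn_integral_cmult)
    moreover have "\<dots> = ?I"
      using k(1) by (intro nn_integral_cong)
        (simp add: h_def norm_mult norm_divide ennreal_mult[symmetric] mult.commute)
    ultimately show ?thesis
      by simp
  qed
  show ?thesis
  proof (cases "orlicz_norm \<mu> \<Phi> g = 0")
    case True
    then show ?thesis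
      using bound orlicz_space_admissible[OF f] by (metis mult_zero_right)
  next
    case False
    \<comment> \<open>The infimum is reached by dividing the Orlicz norm out, which in
      \<open>ennreal\<close> is legitimate because that norm is neither 0 nor infinite here.\<close>
    have "?I / orlicz_norm \<mu> \<Phi> g \<le> luxemburg_norm \<mu> \<Phi> f"
      unfolding luxemburg_norm_def
    proof (rule INF_greatest)
      fix k assume "k \<in> {k. 0 < k \<and> orlicz_modular \<mu> \<Phi> (\<lambda>x. f x / of_real k) \<le> 1}"
      then show "?I / orlicz_norm \<mu> \<Phi> g \<le> ennreal k"
        using bound[of k] False by (intro divide_le_posI_ennreal) (auto simp: mult.commute zero_less_iff_neq_zero)
    qed
    then have "?I / orlicz_norm \<mu> \<Phi> g * orlicz_norm \<mu> \<Phi> g \<le> luxemburg_norm \<mu> \<Phi> f * orlicz_norm \<mu> \<Phi> g"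
      by (rule mult_right_mono) simp
    then show ?thesis
      using False orlicz_norm_finite[OF g] by (simp add: ennreal_divide_times)
  qed
qed

lemma convolution_check:
  "convolution \<mu> f (check_fun g) x = (LINT y|\<mu>. f y * g (- x + y))"
  by (simp add: convolution_def check_fun_def minus_add)

text \<open>Substituting x + y for y moves the translation from \<open>g\<close> to
  \<open>f\<close>, where left invariance leaves the Luxemburg norm unchanged; Hoelder's inequality
  then applies.\<close>

lemma convolution_bound:
  assumes f: "f \<in> orlicz_space \<mu> \<Phi>" and g: "g \<in> orlicz_space \<mu> \<Psi>"
  shows "ennreal (cmod (convolution \<mu> f (check_fun g) x)) \<le> luxemburg_norm \<mu> \<Phi> f * orlicz_norm \<mu> \<Phi> g"
proof -
  have [measurable]: "f \<in> borel_measurable borel" "g \<in> borel_measurable borel"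
    using assms measurable_cong_sets[OF sets_\<mu> refl] by (auto simp: orlicz_space_def)
  define f' where "f' y = f (x + y)" for y
  have modular: "orlicz_modular \<mu> \<Phi> (\<lambda>y. h (x + y)) = orlicz_modular \<mu> \<Phi> h"
    if [measurable]: "h \<in> borel_measurable borel" for h
    unfolding orlicz_modular_eq by (rule nn_integral_translate[of "\<lambda>y. ennreal (\<phi> (cmod (h y)))" x]) measurable
  have "f' \<in> orlicz_space \<mu> \<Phi>"
    using f modular[of "\<lambda>y. of_real _ * f y"] unfolding orlicz_space_def f'_def by auto
  have "luxemburg_norm \<mu> \<Phi> f' = luxemburg_norm \<mu> \<Phi> f"
    using modular[of "\<lambda>y. f y / of_real _"] by (simp add: luxemburg_norm_def f'_def)
  \<comment> \<open>A non-integrable integrand gives the default value 0, for which the bound is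
    trivial.\<close>
  have "ennreal (cmod (convolution \<mu> f (check_fun g) x)) \<le> (\<integral>\<^sup>+ y. ennreal (cmod (f y * g (- x + y))) \<partial>\<mu>)"
    unfolding convolution_check
    by (cases "integrable \<mu> (\<lambda>y. f y * g (- x + y))")
      (auto simp: integral_norm_bound_ennreal not_integrable_integral_eq)
  also have "\<dots> = (\<integral>\<^sup>+ y. ennreal (cmod (f' y * g y)) \<partial>\<mu>)"
    using nn_integral_translate[of "\<lambda>y. ennreal (cmod (f y * g (- x + y)))" x]
    by (simp add: f'_def add.assoc[symmetric])
  also have "\<dots> \<le> luxemburg_norm \<mu> \<Phi> f * orlicz_norm \<mu> \<Phi> g"
    using hoelder[OF \<open>f' \<in> _\<close> g] \<open>luxemburg_norm \<mu> \<Phi> f' = _\<close> by simp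
  finally show ?thesis .
qed

section \<open>The algebra as a vector space of functions with contractive evaluations\<close>

lemma A_norm_bound:
  assumes "u \<in> A_space \<mu> \<Phi> \<Psi>"
  shows "cmod (u x) \<le> A_norm \<mu> \<Phi> \<Psi> u"
proof -
  let ?R = "A_representations \<mu> \<Phi> \<Psi> u"
  let ?I = "INF (f, g)\<in>?R. A_cost \<mu> \<Phi> f g"
  have "ennreal (cmod (u x)) \<le> ?I"
  proof (rule INF_greatest, clarify)
    fix f g assume "(f, g) \<in> ?R"
    then have "\<And>n. f n \<in> orlicz_space \<mu> \<Phi>" "\<And>n. g n \<in> orlicz_space \<mu> \<Psi>"
      "(\<lambda>n. convolution \<mu> (f n) (check_fun (g n)) x) sums u x"
      by (simp_all add: A_representations_def)
    then show "ennreal (cmod (u x)) \<le> A_cost \<mu> \<Phi> f g"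
      unfolding A_cost_def by (intro norm_sums_le[OF _ convolution_bound])
  qed
  \<comment> \<open>\<open>enn2real\<close> sends infinity to 0, so the estimate survives the
    conversion only for a finite infimum.\<close>
  moreover have "?I < \<infinity>"
  proof -
    obtain f g where fg: "(f, g) \<in> ?R"
      using assms unfolding A_space_def by fast
    then have "?I \<le> A_cost \<mu> \<Phi> f g"
      by (intro INF_lower2[OF fg]) simp
    also have "\<dots> < \<infinity>"
      using fg by (simp add: A_representations_def)
    finally show ?thesis .
  qed
  ultimately show ?thesis
    unfolding A_norm_def using enn2real_mono[of "ennreal (cmod (u x))" ?I] by simp
qed

lemma A_space_add:
  assumes "u \<in> A_space \<mu> \<Phi> \<Psi>" "v \<in> A_space \<mu> \<Phi> \<Psi>"
  shows "(\<lambda>x. u x + v x) \<in> A_space \<mu> \<Phi> \<Psi>"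
proof -
  obtain f g f' g' where fg: "(f, g) \<in> A_representations \<mu> \<Phi> \<Psi> u"
    and fg': "(f', g') \<in> A_representations \<mu> \<Phi> \<Psi> v"
    using assms unfolding A_space_def by fast
  define F where "F n = (if even n then f (n div 2) else f' (n div 2))" for n
  define G where "G n = (if even n then g (n div 2) else g' (n div 2))" for n
  have "A_cost \<mu> \<Phi> F G = (\<Sum>n. if even n
      then luxemburg_norm \<mu> \<Phi> (f (n div 2)) * orlicz_norm \<mu> \<Phi> (g (n div 2))
      else luxemburg_norm \<mu> \<Phi> (f' (n div 2)) * orlicz_norm \<mu> \<Phi> (g' (n div 2)))"
    unfolding A_cost_def F_def G_def by (intro suminf_cong) simp
  also have "\<dots> = A_cost \<mu> \<Phi> f g + A_cost \<mu> \<Phi> f' g'"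
    unfolding A_cost_def
    by (rule sums_unique[symmetric], rule sums_interleave) (rule summable_sums[OF summableI])+
  also have "\<dots> < \<infinity>"
    using fg fg' by (simp add: A_representations_def)
  finally have "A_cost \<mu> \<Phi> F G < \<infinity>" .
  moreover have "(\<lambda>n. convolution \<mu> (F n) (check_fun (G n)) x) sums (u x + v x)" for x
  proof -
    have "(\<lambda>n. convolution \<mu> (f n) (check_fun (g n)) x) sums u x"
      "(\<lambda>n. convolution \<mu> (f' n) (check_fun (g' n)) x) sums v x"
      using fg fg' by (simp_all add: A_representations_def)
    from sums_interleave[OF this] show ?thesis
      unfolding F_def G_def by (rule sums_cong[THEN iffD1, rotated]) simp
  qed
  moreover have "F n \<in> orlicz_space \<mu> \<Phi>" "G n \<in> orlicz_space \<mu> \<Psi>" for n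
    using fg fg' by (simp_all add: A_representations_def F_def G_def)
  ultimately have "(F, G) \<in> A_representations \<mu> \<Phi> \<Psi> (\<lambda>x. u x + v x)"
    by (simp add: A_representations_def)
  then show ?thesis
    unfolding A_space_def by blast
qed

lemma orlicz_space_scale:
  assumes "g \<in> orlicz_space \<mu> \<Psi>"
  shows "(\<lambda>x. c * g x) \<in> orlicz_space \<mu> \<Psi>"
proof -
  obtain \<beta> where \<beta>: "0 < \<beta>" "orlicz_modular \<mu> \<Psi> (\<lambda>x. of_real \<beta> * g x) < \<infinity>"
    using assms by (auto simp: orlicz_space_def)
  \<comment> \<open>The denominator \<open>cmod c + 1\<close> instead of \<open>cmod c\<close>
    admits \<open>c = 0\<close> and keeps \<open>t\<close> at most 1.\<close>
  define t where "t = cmod c / (cmod c + 1)"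
  have t: "0 \<le> t" "t \<le> 1"
    by (simp_all add: t_def divide_le_eq_1 add_nonneg_pos)
  have "orlicz_modular \<mu> \<Psi> (\<lambda>x. of_real (\<beta> / (cmod c + 1)) * (c * g x))
      \<le> orlicz_modular \<mu> \<Psi> (\<lambda>x. of_real \<beta> * g x)"
    unfolding orlicz_modular_eq
  proof (intro nn_integral_mono ennreal_leI)
    fix x
    have "cmod (of_real (\<beta> / (cmod c + 1)) * (c * g x)) = t * cmod (of_real \<beta> * g x)"
      unfolding norm_mult norm_of_real t_def using \<beta> by simp
    also have "\<psi> \<dots> \<le> t * \<psi> (cmod (of_real \<beta> * g x))"
      using t by (intro convex_scale_le \<psi>_convex \<psi>_zero)
    also have "\<dots> \<le> \<psi> (cmod (of_real \<beta> * g x))"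
      using t \<psi>_nonneg by (intro mult_left_le_one_le)
    finally show "\<psi> (cmod (of_real (\<beta> / (cmod c + 1)) * (c * g x))) \<le> \<psi> (cmod (of_real \<beta> * g x))" .
  qed
  then have "orlicz_modular \<mu> \<Psi> (\<lambda>x. of_real (\<beta> / (cmod c + 1)) * (c * g x)) < \<infinity>"
    using \<beta>(2) by (rule order_le_less_trans)
  moreover have "0 < \<beta> / (cmod c + 1)"
    using \<beta> by (simp add: add_nonneg_pos)
  ultimately show ?thesis
    using assms unfolding orlicz_space_def by auto
qed

lemma orlicz_norm_scale:
  assumes "g \<in> borel_measurable \<mu>"
  shows "orlicz_norm \<mu> \<Phi> (\<lambda>x. c * g x) = ennreal (cmod c) * orlicz_norm \<mu> \<Phi> g"
  unfolding orlicz_norm_def SUP_mult_left_ennreal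
proof (rule SUP_cong[OF refl])
  fix h assume "h \<in> {h \<in> orlicz_space \<mu> \<Phi>. orlicz_modular \<mu> \<Phi> h \<le> 1}"
  then have h: "h \<in> borel_measurable \<mu>"
    by (auto simp: orlicz_space_def)
  have "(\<integral>\<^sup>+ x. ennreal (cmod (c * g x * h x)) \<partial>\<mu>) = (\<integral>\<^sup>+ x. ennreal (cmod c) * ennreal (cmod (g x * h x)) \<partial>\<mu>)"
    by (intro nn_integral_cong) (simp add: norm_mult ennreal_mult mult.assoc)
  also have "\<dots> = ennreal (cmod c) * (\<integral>\<^sup>+ x. ennreal (cmod (g x * h x)) \<partial>\<mu>)"
    using assms h by (intro nn_integral_cmult) auto
  finally show "(\<integral>\<^sup>+ x. ennreal (cmod (c * g x * h x)) \<partial>\<mu>)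
      = ennreal (cmod c) * (\<integral>\<^sup>+ x. ennreal (cmod (g x * h x)) \<partial>\<mu>)" .
qed

lemma A_space_scale:
  assumes "u \<in> A_space \<mu> \<Phi> \<Psi>"
  shows "(\<lambda>x. c * u x) \<in> A_space \<mu> \<Phi> \<Psi>"
proof -
  obtain f g where fg: "(f, g) \<in> A_representations \<mu> \<Phi> \<Psi> u"
    using assms unfolding A_space_def by fast
  then have g: "g n \<in> orlicz_space \<mu> \<Psi>" for n
    by (simp add: A_representations_def)
  \<comment> \<open>The scalar goes to the second factor: the Orlicz norm, a supremum of integrals,
    is visibly homogeneous even for \<open>c = 0\<close>.\<close>
  define G where "G n x = c * g n x" for n x
  have G: "orlicz_norm \<mu> \<Phi> (G n) = ennreal (cmod c) * orlicz_norm \<mu> \<Phi> (g n)" for n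
    using g[of n] orlicz_norm_scale[of "g n" c] by (simp add: G_def[abs_def] orlicz_space_def)
  have "A_cost \<mu> \<Phi> f G = (\<Sum>n. ennreal (cmod c) * (luxemburg_norm \<mu> \<Phi> (f n) * orlicz_norm \<mu> \<Phi> (g n)))"
    unfolding A_cost_def by (simp only: G mult.left_commute)
  also have "\<dots> = ennreal (cmod c) * A_cost \<mu> \<Phi> f g"
    by (simp add: A_cost_def)
  also have "\<dots> < \<infinity>"
    using fg by (simp add: A_representations_def ennreal_mult_less_top)
  finally have "A_cost \<mu> \<Phi> f G < \<infinity>" .
  moreover have "G n \<in> orlicz_space \<mu> \<Psi>" for n
    using orlicz_space_scale[OF g] by (simp add: G_def[abs_def])
  moreover have "(\<lambda>n. convolution \<mu> (f n) (check_fun (G n)) x) sums (c * u x)" for x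
  proof -
    have "convolution \<mu> (f n) (check_fun (G n)) x = c * convolution \<mu> (f n) (check_fun (g n)) x" for n
      unfolding convolution_check G_def by (simp add: mult.left_commute)
    then show ?thesis
      using fg by (simp add: A_representations_def sums_mult)
  qed
  ultimately have "(f, G) \<in> A_representations \<mu> \<Phi> \<Psi> (\<lambda>x. c * u x)"
    using fg by (simp add: A_representations_def)
  then show ?thesis
    unfolding A_space_def by blast
qed

lemma convolution_in_A:
  assumes f: "f \<in> orlicz_space \<mu> \<Phi>" and g: "g \<in> orlicz_space \<mu> \<Psi>"
  shows "convolution \<mu> f (check_fun g) \<in> A_space \<mu> \<Phi> \<Psi>"
    and "A_norm \<mu> \<Phi> \<Psi> (convolution \<mu> f (check_fun g))
      \<le> enn2real (luxemburg_norm \<mu> \<Phi> f * orlicz_norm \<mu> \<Phi> g)"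
proof -
  let ?u = "convolution \<mu> f (check_fun g)"
  define F where "F n = (if n = 0 then f else (\<lambda>_. 0))" for n :: nat
  define G where "G n = (if n = 0 then g else (\<lambda>_. 0))" for n :: nat
  \<comment> \<open>A single convolution is padded with zero functions; the vanishing Orlicz norm
    makes the cost of each padding term 0.\<close>
  have "orlicz_norm \<mu> \<Phi> (\<lambda>_. 0) = 0"
    using orlicz_norm_scale[of "\<lambda>_. 0" 0] by simp
  then have "A_cost \<mu> \<Phi> F G = (\<Sum>n. if n = 0 then luxemburg_norm \<mu> \<Phi> f * orlicz_norm \<mu> \<Phi> g else 0)"
    unfolding A_cost_def by (intro suminf_cong) (simp add: F_def G_def)
  also have "\<dots> = luxemburg_norm \<mu> \<Phi> f * orlicz_norm \<mu> \<Phi> g"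
    by (rule sums_unique[symmetric, OF sums_single])
  finally have cost: "A_cost \<mu> \<Phi> F G = luxemburg_norm \<mu> \<Phi> f * orlicz_norm \<mu> \<Phi> g" .
  have fin: "luxemburg_norm \<mu> \<Phi> f * orlicz_norm \<mu> \<Phi> g < \<infinity>"
    using luxemburg_norm_finite[OF f] orlicz_norm_finite[OF g] by (simp add: ennreal_mult_less_top)
  have zero: "(\<lambda>_. 0) \<in> orlicz_space \<mu> \<Phi>" "(\<lambda>_. 0) \<in> orlicz_space \<mu> \<Psi>"
    unfolding orlicz_space_def by (auto simp: orlicz_modular_eq \<phi>_zero \<psi>_zero intro!: exI[of _ 1])
  have "(\<lambda>n. convolution \<mu> (F n) (check_fun (G n)) x) sums ?u x" for x
  proof -
    have "(\<lambda>n. convolution \<mu> (F n) (check_fun (G n)) x) = (\<lambda>n. if n = 0 then ?u x else 0)"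
      by (auto simp: F_def G_def convolution_def)
    then show ?thesis
      using sums_single[of 0 "\<lambda>_. ?u x"] by simp
  qed
  then have FG: "(F, G) \<in> A_representations \<mu> \<Phi> \<Psi> ?u"
    using f g zero cost fin by (simp add: A_representations_def F_def G_def)
  then show "?u \<in> A_space \<mu> \<Phi> \<Psi>"
    unfolding A_space_def by blast
  have "(INF (f, g)\<in>A_representations \<mu> \<Phi> \<Psi> ?u. A_cost \<mu> \<Phi> f g) \<le> A_cost \<mu> \<Phi> F G"
    by (intro INF_lower2[OF FG]) simp
  then show "A_norm \<mu> \<Phi> \<Psi> ?u \<le> enn2real (luxemburg_norm \<mu> \<Phi> f * orlicz_norm \<mu> \<Phi> g)"
    unfolding A_norm_def cost using fin by (intro enn2real_mono) auto
qed

section \<open>Indicator functions and their overlaps\<close>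

lemma nn_integral_indicator_comp:
  fixes \<theta> :: "real \<Rightarrow> real"
  assumes "\<theta> 0 = 0" "E \<in> sets borel"
  shows "(\<integral>\<^sup>+ x. ennreal (\<theta> (c * indicator E x)) \<partial>\<mu>) = ennreal (\<theta> c) * emeasure \<mu> E"
proof -
  have "(\<integral>\<^sup>+ x. ennreal (\<theta> (c * indicator E x)) \<partial>\<mu>) = (\<integral>\<^sup>+ x. ennreal (\<theta> c) * indicator E x \<partial>\<mu>)"
    by (intro nn_integral_cong) (simp add: indicator_def assms)
  then show ?thesis
    using assms by (simp add: nn_integral_cmult_indicator)
qed

lemma indicator_in_orlicz_space:
  assumes "E \<in> sets borel" "emeasure \<mu> E < \<infinity>"
  shows "(\<lambda>x. c * of_real (indicator E x)) \<in> orlicz_space \<mu> \<Phi>"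
    and "(\<lambda>x. c * of_real (indicator E x)) \<in> orlicz_space \<mu> \<Psi>"
  using assms unfolding orlicz_space_def
  by (auto simp: orlicz_modular_eq norm_mult nn_integral_indicator_comp \<phi>_zero \<psi>_zero ennreal_mult_less_top
      intro!: exI[of _ 1])

text \<open>With \<open>F = E\<close> and \<open>c\<close> the reciprocal of the measure of
  \<open>E\<close> this is the overlap function; with one-point sets it yields the point masses on a
  finite group.\<close>

lemma convolution_indicators:
  assumes [measurable]: "E \<in> sets borel" "F \<in> sets borel"
  shows "convolution \<mu> (\<lambda>x. of_real (indicator E x)) (check_fun (\<lambda>x. c * of_real (indicator F x))) x
    = c * of_real (measure \<mu> (E \<inter> (+) x ` F))"
proof -
  have "- x + y \<in> F \<longleftrightarrow> y \<in> (+) x ` F" for y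
    by (metis add_minus_cancel image_iff minus_add_cancel)
  then have *: "of_real (indicator E y) * (c * of_real (indicator F (- x + y)))
      = c * complex_of_real (indicator (E \<inter> (+) x ` F) y)" for y
    by (simp add: indicator_def)
  show ?thesis
    unfolding convolution_check * by simp
qed

text \<open>
  With \<open>\<phi> s = 1 / \<mu> E\<close> one has \<open>N\<^sub>\<Phi>(1\<^sub>E) \<le> 1 / s\<close> and, by the supporting line of \<open>\<phi>\<close> at \<open>s\<close>
  (Jensen's inequality), \<open>\<parallel>1\<^sub>E\<parallel>\<^sub>\<Psi> \<le> s \<mu> E\<close>.
\<close>

lemma overlap_in_A:
  assumes E [measurable]: "E \<in> sets borel" and "0 < emeasure \<mu> E" "emeasure \<mu> E < \<infinity>"
  defines "u \<equiv> \<lambda>x. complex_of_real (measure \<mu> (E \<inter> (+) x ` E) / measure \<mu> E)"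
  shows "u \<in> A_space \<mu> \<Phi> \<Psi>" "A_norm \<mu> \<Phi> \<Psi> u \<le> 1"
proof -
  define m where "m = measure \<mu> E"
  have mE: "emeasure \<mu> E = ennreal m"
    unfolding m_def using assms(3) by (intro emeasure_eq_ennreal_measure) simp
  then have "0 < m"
    using assms(2) by simp
  note m = this mE
  define f where "f x = complex_of_real (indicator E x)" for x
  define g where "g x = complex_of_real (1 / m) * complex_of_real (indicator E x)" for x
  have f: "f \<in> orlicz_space \<mu> \<Phi>"
    using indicator_in_orlicz_space(1)[OF E assms(3), of 1] by (simp add: f_def[abs_def])
  have g: "g \<in> orlicz_space \<mu> \<Psi>"
    unfolding g_def[abs_def] by (rule indicator_in_orlicz_space(2)[OF E assms(3)])
  have u: "u = convolution \<mu> f (check_fun g)"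
    unfolding u_def f_def[abs_def] g_def[abs_def] by (rule ext, subst convolution_indicators[OF E E]) (simp add: m_def)
  \<comment> \<open>Unboundedness of \<open>\<phi>\<close> and continuity give the point
    \<open>s\<close> where \<open>\<phi>\<close> equals 1 / m; \<open>p\<close> below is the slope
    of a supporting line there.\<close>
  have "\<forall>\<^sub>F x in at_top. 1 / m \<le> \<phi> x \<and> 0 \<le> x"
    using \<phi>_at_top by (intro eventually_conj eventually_ge_at_top) (simp add: filterlim_at_top)
  then obtain b where b: "0 \<le> b" "1 / m \<le> \<phi> b"
    using eventually_happens'[OF trivial_limit_at_top_linorder] by blast
  have "continuous_on {0..b} \<phi>"
    using convex_on_continuous[OF open_UNIV \<phi>_convex] continuous_on_subset by blast
  then obtain s where s: "0 \<le> s" "\<phi> s = 1 / m"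
    using IVT'[of \<phi> 0 "1 / m" b] b m \<phi>_zero by auto
  have "0 < s"
    using s m \<phi>_zero by (cases "s = 0") auto
  obtain p where p: "\<And>t. \<phi> s + p * (t - s) \<le> \<phi> t"
    using convex_le_Inf_differential[OF \<phi>_convex, of s] by fastforce
  have "0 < p"
  proof -
    have "1 / m \<le> p * s"
      using p[of 0] s \<phi>_zero by simp
    moreover have "0 < 1 / m"
      using m by simp
    ultimately have "0 < p * s"
      by linarith
    then show ?thesis
      using \<open>0 < s\<close> by (simp add: zero_less_mult_iff)
  qed
  have "luxemburg_norm \<mu> \<Phi> f \<le> ennreal (1 / s)"
  proof (rule luxemburg_norm_le)
    have "orlicz_modular \<mu> \<Phi> (\<lambda>x. f x / of_real (1 / s)) = (\<integral>\<^sup>+ x. ennreal (\<phi> (s * indicator E x)) \<partial>\<mu>)"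
      using \<open>0 < s\<close> by (simp add: orlicz_modular_eq f_def norm_mult mult.commute)
    also have "\<dots> = 1"
      using m s by (simp add: nn_integral_indicator_comp \<phi>_zero ennreal_mult[symmetric])
    finally show "orlicz_modular \<mu> \<Phi> (\<lambda>x. f x / of_real (1 / s)) \<le> 1"
      by simp
  qed (use \<open>0 < s\<close> in simp)
  moreover have "orlicz_norm \<mu> \<Phi> g \<le> ennreal s"
    unfolding orlicz_norm_def
  proof (rule SUP_least)
    fix h assume h: "h \<in> {h \<in> orlicz_space \<mu> \<Phi>. orlicz_modular \<mu> \<Phi> h \<le> 1}"
    then have [measurable]: "h \<in> borel_measurable borel"
      using measurable_cong_sets[OF sets_\<mu> refl] by (auto simp: orlicz_space_def)
    define I where "I = (\<integral>\<^sup>+ x. ennreal (cmod (h x)) * indicator E x \<partial>\<mu>)"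
    \<comment> \<open>The supporting line at |h|, integrated over \<open>E\<close> and arranged so
      that all terms are nonnegative. The 1 is the integral of 1 / m over \<open>E\<close>; it
      cancels against the bound 1 for the modular of \<open>h\<close>, leaving \<open>I\<close> at
      most s m.\<close>
    have "ennreal p * I + 1
        = (\<integral>\<^sup>+ x. ennreal p * (ennreal (cmod (h x)) * indicator E x) + ennreal (1 / m) * indicator E x \<partial>\<mu>)"
      unfolding I_def using m
      by (simp add: nn_integral_add nn_integral_cmult nn_integral_cmult_indicator ennreal_mult[symmetric])
    also have "\<dots> \<le> (\<integral>\<^sup>+ x. ennreal (\<phi> (cmod (h x))) + ennreal (p * s) * indicator E x \<partial>\<mu>)"
    proof (intro nn_integral_mono)
      fix x
      have "p * cmod (h x) + 1 / m \<le> \<phi> (cmod (h x)) + p * s"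
        using p[of "cmod (h x)"] s by (simp add: algebra_simps)
      then have "ennreal (p * cmod (h x) + 1 / m) \<le> ennreal (\<phi> (cmod (h x)) + p * s)"
        by (rule ennreal_leI)
      then show "ennreal p * (ennreal (cmod (h x)) * indicator E x) + ennreal (1 / m) * indicator E x
          \<le> ennreal (\<phi> (cmod (h x))) + ennreal (p * s) * indicator E x"
        using \<open>0 < p\<close> \<open>0 < s\<close> m \<phi>_nonneg by (simp add: indicator_def ennreal_mult)
    qed
    also have "\<dots> = orlicz_modular \<mu> \<Phi> h + ennreal (p * s * m)"
      using m \<open>0 < p\<close> \<open>0 < s\<close>
      by (simp add: nn_integral_add nn_integral_cmult_indicator orlicz_modular_eq ennreal_mult)
    also have "\<dots> \<le> 1 + ennreal (p * s * m)"
      using h by (intro add_right_mono) simp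
    finally have "1 + ennreal p * I \<le> 1 + ennreal (p * s * m)"
      by (simp only: add.commute)
    then have "ennreal p * I \<le> ennreal (p * s * m)"
      by (subst (asm) ennreal_add_left_cancel_le) simp
    then have "ennreal (1 / (p * m)) * (ennreal p * I) \<le> ennreal (1 / (p * m)) * ennreal (p * s * m)"
      by (rule mult_left_mono) simp
    then have "ennreal (1 / m) * I \<le> ennreal s"
      using \<open>0 < p\<close> \<open>0 < s\<close> m by (simp add: mult.assoc[symmetric] ennreal_mult[symmetric])
    moreover have "(\<integral>\<^sup>+ x. ennreal (cmod (g x * h x)) \<partial>\<mu>)
        = (\<integral>\<^sup>+ x. ennreal (1 / m) * (ennreal (cmod (h x)) * indicator E x) \<partial>\<mu>)"
      using m by (intro nn_integral_cong) (simp add: g_def norm_mult norm_divide indicator_def ennreal_mult[symmetric])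
    then have "(\<integral>\<^sup>+ x. ennreal (cmod (g x * h x)) \<partial>\<mu>) = ennreal (1 / m) * I"
      by (simp add: I_def nn_integral_cmult)
    ultimately show "(\<integral>\<^sup>+ x. ennreal (cmod (g x * h x)) \<partial>\<mu>) \<le> ennreal s"
      by simp
  qed
  ultimately have "luxemburg_norm \<mu> \<Phi> f * orlicz_norm \<mu> \<Phi> g \<le> ennreal (1 / s) * ennreal s"
    by (rule mult_mono) auto
  then have "luxemburg_norm \<mu> \<Phi> f * orlicz_norm \<mu> \<Phi> g \<le> 1"
    using \<open>0 < s\<close> by (simp add: ennreal_mult[symmetric])
  then have "enn2real (luxemburg_norm \<mu> \<Phi> f * orlicz_norm \<mu> \<Phi> g) \<le> 1"
    using enn2real_mono[of _ 1] by simp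
  then show "u \<in> A_space \<mu> \<Phi> \<Psi>" "A_norm \<mu> \<Phi> \<Psi> u \<le> 1"
    using convolution_in_A[OF f g] by (simp_all add: u)
qed

section \<open>Failure of reflexivity on infinite groups\<close>

lemma compact_emeasure_finite: "compact K \<Longrightarrow> emeasure \<mu> K < \<infinity>"
  using haar unfolding left_haar_measure_def by blast

lemma open_emeasure_eq: "open U \<Longrightarrow> emeasure \<mu> U = (SUP K\<in>{K. compact K \<and> K \<subseteq> U}. emeasure \<mu> K)"
  using haar unfolding left_haar_measure_def by blast

lemma open_translate:
  assumes "open (U :: 'a set)"
  shows "open ((+) x ` U)"
proof -
  have "(+) x ` U = (\<lambda>y. - x + y) -` U"
    by (force simp: add.assoc[symmetric] image_iff)
  then show ?thesis
    using assms by (simp add: open_vimage continuous_intros)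
qed

text \<open>Inner regularity provides a compact set of positive measure, and finitely many
  translates of \<open>U\<close>, all of the same measure, cover it.\<close>

lemma open_emeasure_pos:
  assumes U: "open U" "0 \<in> U"
  shows "0 < emeasure \<mu> U"
proof (rule ccontr)
  assume "\<not> ?thesis"
  then have null: "emeasure \<mu> U = 0"
    by (simp add: zero_less_iff_neq_zero)
  have "0 < emeasure \<mu> UNIV"
    using haar unfolding left_haar_measure_def zero_less_iff_neq_zero by blast
  then obtain K where K: "compact K" "0 < emeasure \<mu> K"
    using open_emeasure_eq[of UNIV] by (auto simp: less_SUP_iff)
  have "K \<subseteq> (\<Union>x\<in>K. (+) x ` U)"
    using U(2) by force
  then obtain F where F: "F \<subseteq> K" "finite F" "K \<subseteq> (\<Union>x\<in>F. (+) x ` U)"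
    using compactE_image[OF K(1), of K "\<lambda>x. (+) x ` U"] open_translate[OF U(1)] by blast
  have "emeasure \<mu> K \<le> emeasure \<mu> (\<Union>x\<in>F. (+) x ` U)"
    using F open_translate[OF U(1)] by (intro emeasure_mono) (auto intro!: borel_open)
  also have "\<dots> \<le> (\<Sum>x\<in>F. emeasure \<mu> ((+) x ` U))"
    using F open_translate[OF U(1)] by (intro emeasure_subadditive_finite) (auto intro!: borel_open)
  also have "\<dots> = 0"
    using U(1) null by (simp add: emeasure_translate)
  finally show False
    using K(2) by simp
qed

lemma measure_pos:
  assumes "0 < emeasure \<mu> E" "emeasure \<mu> E < \<infinity>"
  shows "0 < measure \<mu> E"
  using assms by (simp add: measure_def enn2real_positive_iff)

text \<open>Inner regularity gives a compact \<open>K\<close> in \<open>E\<close> carrying more than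
  half of the measure. By the tube lemma x + K stays inside \<open>E\<close> for \<open>x\<close>
  near 0, so the overlap contains a translate of \<open>K\<close>.\<close>

lemma overlap_near_zero:
  assumes E: "open E" "0 < emeasure \<mu> E" "emeasure \<mu> E < \<infinity>"
  shows "\<forall>\<^sub>F x in nhds 0. 1 / 2 \<le> measure \<mu> (E \<inter> (+) x ` E) / measure \<mu> E"
proof -
  have m: "0 < measure \<mu> E" "emeasure \<mu> E = ennreal (measure \<mu> E)"
    using E measure_pos by (auto intro: emeasure_eq_ennreal_measure)
  then have "ennreal (measure \<mu> E / 2) < emeasure \<mu> E"
    by (simp add: ennreal_less_iff)
  then obtain K where K: "compact K" "K \<subseteq> E" "ennreal (measure \<mu> E / 2) < emeasure \<mu> K"
    using open_emeasure_eq[OF E(1)] by (auto simp: less_SUP_iff)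
  have "open ((\<lambda>p. fst p + snd p) -` E)"
    using E(1) by (intro open_vimage continuous_intros)
  moreover have "{0} \<times> K \<subseteq> (\<lambda>p. fst p + snd p) -` E"
    using K(2) by auto
  ultimately have "\<exists>U. 0 \<in> U \<and> open U \<and> U \<times> K \<subseteq> (\<lambda>p. fst p + snd p) -` E"
    by (rule Elementary_Topology.tube_lemma[OF K(1)])
  then obtain U where U: "0 \<in> U" "open U" "U \<times> K \<subseteq> (\<lambda>p. fst p + snd p) -` E"
    by (elim exE conjE)
  have "1 / 2 \<le> measure \<mu> (E \<inter> (+) x ` E) / measure \<mu> E" if "x \<in> U" for x
  proof -
    have borel: "E \<inter> (+) x ` E \<in> sets borel"
      using E(1) open_translate[OF E(1)] by (intro sets.Int borel_open)
    have "(+) x ` K \<subseteq> E \<inter> (+) x ` E"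
      using U(3) that K(2) by auto
    then have "emeasure \<mu> ((+) x ` K) \<le> emeasure \<mu> (E \<inter> (+) x ` E)"
      using borel by (intro emeasure_mono) auto
    then have "ennreal (measure \<mu> E / 2) < emeasure \<mu> (E \<inter> (+) x ` E)"
      using K by (simp add: emeasure_translate borel_compact)
    moreover have "emeasure \<mu> (E \<inter> (+) x ` E) < \<infinity>"
      using E borel by (intro order_le_less_trans[OF emeasure_mono E(3)]) auto
    then have "emeasure \<mu> (E \<inter> (+) x ` E) = ennreal (measure \<mu> (E \<inter> (+) x ` E))"
      by (intro emeasure_eq_ennreal_measure) simp
    ultimately have "measure \<mu> E / 2 < measure \<mu> (E \<inter> (+) x ` E)"
      by (simp add: ennreal_less_iff)
    then show ?thesis
      using m by (simp add: field_simps)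
  qed
  then show ?thesis
    using U unfolding eventually_nhds by blast
qed

lemma closed_Re_ge: "closed {z. 1 / 2 \<le> Re z}"
  by (intro closed_Collect_le continuous_intros)

lemma not_reflexive_nondiscrete:
  assumes "locally compact (UNIV :: 'a set)" and "\<not> open {0 :: 'a}"
  shows "\<not> reflexive_space (A_space \<mu> \<Phi> \<Psi>) (A_norm \<mu> \<Phi> \<Psi>)"
proof (rule not_reflexive_double_limit[where Q = "at 0" and Y = "- {0}" and C = "{0}" and D = "{z. 1 / 2 \<le> Re z}"])
  show "at (0 :: 'a) \<noteq> bot"
    using assms(2) by (simp add: at_eq_bot_iff)
  show "\<forall>\<^sub>F x in at 0. x \<in> - {0 :: 'a}"
    by (simp add: eventually_at_filter)
  fix X :: "'a set" assume X: "finite X" "X \<subseteq> - {0}"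
  obtain V K :: "'a set" where V: "open V" "0 \<in> V" "V \<subseteq> K" "compact K"
  proof -
    have "\<exists>V K. openin (top_of_set UNIV) V \<and> compact K \<and> (0 :: 'a) \<in> V \<and> V \<subseteq> K \<and> K \<subseteq> UNIV"
      by (rule assms(1)[unfolded locally_def, rule_format]) simp
    then show thesis
      using that by auto
  qed
  \<comment> \<open>Subtraction is continuous at the origin and 0 is not in the closed set
    \<open>X\<close>, so near 0 no difference lands in \<open>X\<close>. Then \<open>E\<close>
    misses its translates by points of \<open>X\<close>; intersecting with \<open>V\<close> keeps
    its measure finite.\<close>
  have "open ((\<lambda>p :: 'a \<times> 'a. fst p - snd p) -` (- X))"
    using X by (intro open_vimage continuous_intros) (auto simp: finite_imp_closed open_Compl)
  moreover have "(0, 0) \<in> (\<lambda>p :: 'a \<times> 'a. fst p - snd p) -` (- X)"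
    using X by auto
  ultimately obtain A B where AB: "open A" "open B" "(0, 0) \<in> A \<times> B"
    "A \<times> B \<subseteq> (\<lambda>p :: 'a \<times> 'a. fst p - snd p) -` (- X)"
    by (rule open_prod_elim)
  define E where "E = A \<inter> B \<inter> V"
  have E: "open E" "0 \<in> E" "E \<subseteq> K"
    using AB V by (auto simp: E_def)
  then have pos: "0 < emeasure \<mu> E"
    by (intro open_emeasure_pos)
  have "emeasure \<mu> E \<le> emeasure \<mu> K"
    using E V by (intro emeasure_mono) (auto simp: borel_compact)
  then have fin: "emeasure \<mu> E < \<infinity>"
    using compact_emeasure_finite[OF V(4)] by (rule order_le_less_trans)
  let ?u = "\<lambda>x. complex_of_real (measure \<mu> (E \<inter> (+) x ` E) / measure \<mu> E)"
  have "?u x = 0" if "x \<in> X" for x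
  proof -
    have "x + b \<notin> E" if "b \<in> E" for b
    proof
      assume "x + b \<in> E"
      then have "(x + b, b) \<in> A \<times> B"
        using that by (auto simp: E_def)
      then show False
        using AB(4) \<open>x \<in> X\<close> by auto
    qed
    then have "E \<inter> (+) x ` E = {}"
      by blast
    then show ?thesis
      by simp
  qed
  moreover have "\<forall>\<^sub>F x in at 0. ?u x \<in> {z. 1 / 2 \<le> Re z}"
    using overlap_near_zero[OF E(1) pos fin] unfolding eventually_at_filter by eventually_elim simp
  ultimately show "\<exists>u\<in>A_space \<mu> \<Phi> \<Psi>. A_norm \<mu> \<Phi> \<Psi> u \<le> 1 \<and> (\<forall>x\<in>X. u x \<in> {0}) \<and>
      (\<forall>\<^sub>F x in at 0. u x \<in> {z. 1 / 2 \<le> Re z})"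
    using overlap_in_A[OF _ pos fin] E(1) by (intro bexI[of _ ?u]) auto
qed (use closed_Re_ge in \<open>auto intro: A_space_add A_space_scale A_norm_bound\<close>)

section \<open>Discrete groups: Haar measure as a multiple of counting measure\<close>

lemma discrete_open:
  assumes "open {0 :: 'a}"
  shows "open (S :: 'a set)"
proof -
  have "S = (\<Union>x\<in>S. (+) x ` {0})"
    by auto
  then show ?thesis
    using open_translate[OF assms] by (metis open_UN)
qed

lemma discrete_measure:
  assumes "open {0 :: 'a}" "finite E"
  shows "emeasure \<mu> E < \<infinity>" "measure \<mu> E = measure \<mu> {0} * card E" "0 < measure \<mu> {0}"
proof -
  have borel: "S \<in> sets borel" for S :: "'a set"
    using discrete_open[OF assms(1)] by (rule borel_open)
  have fin: "emeasure \<mu> S < \<infinity>" if "finite S" for S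
    using that by (intro compact_emeasure_finite finite_imp_compact)
  then show "emeasure \<mu> E < \<infinity>"
    using assms(2) by blast
  have "measure \<mu> E = (\<Sum>x\<in>E. measure \<mu> {x})"
    using assms(2) fin borel by (intro measure_eq_sum_singleton) (auto simp: less_top)
  also have "\<dots> = (\<Sum>x\<in>E. measure \<mu> {0})"
  proof (rule sum.cong[OF refl])
    show "measure \<mu> {x} = measure \<mu> {0}" for x
      using emeasure_translate[of "{0}" x] borel by (simp add: measure_def)
  qed
  finally show "measure \<mu> E = measure \<mu> {0} * card E"
    by simp
  show "0 < measure \<mu> {0}"
    using fin open_emeasure_pos[OF assms(1)] by (intro measure_pos) auto
qed

lemma not_reflexive_discrete_infinite:
  assumes "amenable \<mu>" "open {0 :: 'a}" "infinite (UNIV :: 'a set)"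
  shows "\<not> reflexive_space (A_space \<mu> \<Phi> \<Psi>) (A_norm \<mu> \<Phi> \<Psi>)"
proof (rule not_reflexive_double_limit[where Q = cofinite and Y = UNIV and C = "{z. 1 / 2 \<le> Re z}" and D = "{0}"])
  show "(cofinite :: 'a filter) \<noteq> bot"
    using assms(3) by simp
  have borel: "S \<in> sets borel" for S :: "'a set"
    using discrete_open[OF assms(2)] by (rule borel_open)
  obtain m where m: "left_invariant_mean \<mu> m"
    using assms(1) by (auto simp: amenable_def)
  \<comment> \<open>On a discrete group every function is Borel, so the mean is available on all
    bounded functions.\<close>
  have bb: "f \<in> bounded_borel" if "bounded (range f)" for f :: "'a \<Rightarrow> real"
    using that borel by (simp add: bounded_borel_def measurable_def)
  fix X :: "'a set" assume "finite X"
  \<comment> \<open>Inserting 0 puts \<open>E\<close> itself into the union. Hence |E \<union> (x +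
    E)| < 3/2 |E| for \<open>x\<close> in \<open>X\<close>, which forces an overlap of more than
    half of \<open>E\<close>.\<close>
  have "\<exists>E. finite E \<and> E \<noteq> {} \<and> 2 * card (\<Union>s\<in>insert 0 X. (+) s ` E) < 3 * card E"
  proof (rule foelner_set_exists[where m = m])
    show "m (\<lambda>x. f x + g x) = m f + m g" if "bounded (range f)" "bounded (range g)" for f g
      using m that bb by (simp add: left_invariant_mean_def)
    show "0 \<le> m f" if "bounded (range f)" "\<And>x. 0 \<le> f x" for f
    proof -
      have "{x \<in> K. f x < 0} = {}" for K
        using that(2) by (auto simp: not_less)
      then have "\<forall>K. compact K \<longrightarrow> emeasure \<mu> {x \<in> K. f x < 0} = 0"
        by (simp only: emeasure_empty simp_thms)
      then show ?thesis
        using m bb[OF that(1)] unfolding left_invariant_mean_def by blast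
    qed
    show "m (\<lambda>_. 1) = 1"
      using m by (simp add: left_invariant_mean_def)
    show "m (\<lambda>x. f (a + x)) = m f" if "bounded (range f)" for a f
      using m that bb by (simp add: left_invariant_mean_def)
  qed (use \<open>finite X\<close> in simp)
  then obtain E where E: "finite E" "E \<noteq> {}" "2 * card (\<Union>s\<in>insert 0 X. (+) s ` E) < 3 * card E"
    by blast
  note dm = discrete_measure[OF assms(2)]
  let ?u = "\<lambda>x. complex_of_real (measure \<mu> (E \<inter> (+) x ` E) / measure \<mu> E)"
  have mE: "0 < measure \<mu> E"
    using dm(2,3)[OF E(1)] E by (simp add: card_gt_0_iff)
  then have pos: "0 < emeasure \<mu> E"
    by (metis measure_eq_emeasure_eq_ennreal measure_def enn2real_0 less_irrefl zero_less_iff_neq_zero)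
  have u: "?u x = complex_of_real (card (E \<inter> (+) x ` E) / card E)" for x
    using dm(2)[of E] dm(2)[of "E \<inter> (+) x ` E"] dm(3)[OF E(1)] E by simp
  have "1 / 2 \<le> Re (?u x)" if "x \<in> X" for x
  proof -
    have "card (E \<union> (+) x ` E) \<le> card (\<Union>s\<in>insert 0 X. (+) s ` E)"
      using E(1) \<open>finite X\<close> that by (intro card_mono) auto
    moreover have "card E + card ((+) x ` E) = card (E \<union> (+) x ` E) + card (E \<inter> (+) x ` E)"
      using E(1) by (intro card_Un_Int) auto
    moreover have "card ((+) x ` E) = card E"
      by (simp add: card_image)
    ultimately have "card E \<le> 2 * card (E \<inter> (+) x ` E)"
      using E(3) by linarith
    moreover have "0 < card E"
      using E by (simp add: card_gt_0_iff)
    ultimately show ?thesis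
      unfolding u by (simp add: field_simps)
  qed
  moreover have "\<forall>\<^sub>F x in cofinite. ?u x \<in> {0}"
  proof -
    \<comment> \<open>The overlap function lives on the differences of elements of \<open>E\<close>,
      a finite set.\<close>
    have "{x. ?u x \<noteq> 0} \<subseteq> (\<lambda>(a, b). a - b) ` (E \<times> E)"
    proof
      fix x assume "x \<in> {x. ?u x \<noteq> 0}"
      then have "E \<inter> (+) x ` E \<noteq> {}"
        by auto
      then obtain a b where "a \<in> E" "b \<in> E" "a = x + b"
        by blast
      then show "x \<in> (\<lambda>(a, b). a - b) ` (E \<times> E)"
        by force
    qed
    then have "finite {x. ?u x \<noteq> 0}"
      by (rule finite_subset) (simp add: E(1))
    then show ?thesis
      by (simp only: eventually_cofinite singleton_iff)
  qed
  ultimately show "\<exists>u\<in>A_space \<mu> \<Phi> \<Psi>. A_norm \<mu> \<Phi> \<Psi> u \<le> 1 \<and> (\<forall>x\<in>X. u x \<in> {z. 1 / 2 \<le> Re z}) \<and>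
      (\<forall>\<^sub>F x in cofinite. u x \<in> {0})"
    using overlap_in_A[OF borel pos dm(1)[OF E(1)]] by (intro bexI[of _ ?u]) auto
qed (use closed_Re_ge in \<open>auto intro: A_space_add A_space_scale A_norm_bound\<close>)

text \<open>A finite Hausdorff group is discrete, and convolving the indicators of
  \<open>{a}\<close> and \<open>{0}\<close> gives a positive multiple of the point mass at
  \<open>a\<close>; these span all functions.\<close>

lemma A_space_finite_group:
  assumes fin: "finite (UNIV :: 'a set)"
  shows "A_space \<mu> \<Phi> \<Psi> = UNIV"
proof (intro equalityI subset_UNIV subsetI)
  fix u :: "'a \<Rightarrow> complex"
  have disc: "open {0 :: 'a}"
    using finite_imp_closed[OF finite_subset[OF subset_UNIV fin], of "- {0}"] by (simp add: closed_def)
  have borel: "S \<in> sets borel" for S :: "'a set"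
    using discrete_open[OF disc] by (rule borel_open)
  define c where "c = measure \<mu> {0}"
  have "0 < c"
    using discrete_measure(3)[OF disc finite.emptyI] by (simp add: c_def)
  have point: "(\<lambda>x. complex_of_real (measure \<mu> ({a} \<inter> {x}))) \<in> A_space \<mu> \<Phi> \<Psi>" for a
  proof -
    have "convolution \<mu> (\<lambda>x. of_real (indicator {a} x)) (check_fun (\<lambda>x. 1 * of_real (indicator {0} x)))
        \<in> A_space \<mu> \<Phi> \<Psi>"
      using indicator_in_orlicz_space(1)[OF borel discrete_measure(1)[OF disc], of "{a}" 1]
        indicator_in_orlicz_space(2)[OF borel discrete_measure(1)[OF disc], of "{0}" 1]
      by (intro convolution_in_A) auto
    moreover have "convolution \<mu> (\<lambda>x. of_real (indicator {a} x)) (check_fun (\<lambda>x. 1 * of_real (indicator {0} x)))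
        = (\<lambda>x. complex_of_real (measure \<mu> ({a} \<inter> {x})))"
      by (rule ext, subst convolution_indicators[OF borel borel]) simp
    ultimately show ?thesis
      by simp
  qed
  have span: "(\<lambda>x. \<Sum>a\<in>S. u a / of_real c * of_real (measure \<mu> ({a} \<inter> {x}))) \<in> A_space \<mu> \<Phi> \<Psi>" if "finite S" for S
    using that
  proof induction
    case empty
    then show ?case
      using A_space_scale[OF point, of 0] by simp
  next
    case (insert a S)
    show ?case
      using A_space_add[OF A_space_scale[OF point[of a], of "u a / of_real c"] insert.IH]
      unfolding sum.insert[OF insert.hyps] .
  qed
  have "(\<lambda>x. \<Sum>a\<in>UNIV. u a / of_real c * of_real (measure \<mu> ({a} \<inter> {x}))) = u"
  proof
    fix x
    have "u a / of_real c * of_real (measure \<mu> ({a} \<inter> {x})) = (if a = x then u a else 0)" for a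
      using \<open>0 < c\<close> discrete_measure(2)[OF disc, of "{x}"] by (auto simp: c_def)
    then show "(\<Sum>a\<in>UNIV. u a / of_real c * of_real (measure \<mu> ({a} \<inter> {x}))) = u x"
      using fin by simp
  qed
  then show "u \<in> A_space \<mu> \<Phi> \<Psi>"
    using span[OF fin] by (simp only:)
qed

lemma reflexive_iff_finite:
  assumes "locally compact (UNIV :: 'a set)" "amenable \<mu>"
  shows "reflexive_space (A_space \<mu> \<Phi> \<Psi>) (A_norm \<mu> \<Phi> \<Psi>) \<longleftrightarrow> finite (UNIV :: 'a set)"
proof
  assume "reflexive_space (A_space \<mu> \<Phi> \<Psi>) (A_norm \<mu> \<Phi> \<Psi>)"
  then show "finite (UNIV :: 'a set)"
    using not_reflexive_nondiscrete[OF assms(1)] not_reflexive_discrete_infinite[OF assms(2)] by blast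
next
  assume fin: "finite (UNIV :: 'a set)"
  have "cmod (u x) \<le> A_norm \<mu> \<Phi> \<Psi> u" for u x
    by (rule A_norm_bound) (simp add: A_space_finite_group[OF fin])
  then show "reflexive_space (A_space \<mu> \<Phi> \<Psi>) (A_norm \<mu> \<Phi> \<Psi>)"
    unfolding A_space_finite_group[OF fin] by (rule reflexive_space_finite[OF fin])
qed

end

theorem corollary3p10:
  fixes \<mu> :: "'a::{topological_group_add, t2_space} measure"
    and \<Phi> \<Psi> :: "real \<Rightarrow> ereal"
  assumes "locally compact (UNIV :: 'a set)"
    and "left_haar_measure \<mu>"
    and "amenable \<mu>"
    and "complementary_pair \<Phi> \<Psi>"
    and "delta2 (UNIV :: 'a set) \<Phi>"
    and "delta2 (UNIV :: 'a set) \<Psi>"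
    and "MA_condition \<Phi>"
  shows "reflexive_space (A_space \<mu> \<Phi> \<Psi>) (A_norm \<mu> \<Phi> \<Psi>) \<longleftrightarrow> finite (UNIV :: 'a set)"
proof -
  have "young_function \<Phi>" "young_function \<Psi>" and \<Psi>: "\<Psi> = complementary_young \<Phi>"
    using assms(4) by (auto simp: complementary_pair_def)
  obtain \<phi> where \<phi>: "\<Phi> = (\<lambda>x. ereal (\<phi> x))" "\<And>x. 0 \<le> \<phi> x" "\<phi> 0 = 0"
      "convex_on UNIV \<phi>" "filterlim \<phi> at_top at_top"
    using assms(5) finite_young_function[OF \<open>young_function \<Phi>\<close>] unfolding delta2_def by blast
  obtain \<psi> where \<psi>: "\<Psi> = (\<lambda>x. ereal (\<psi> x))" "\<And>x. 0 \<le> \<psi> x" "\<psi> 0 = 0" "convex_on UNIV \<psi>"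
    using assms(6) finite_young_function[OF \<open>young_function \<Psi>\<close>] unfolding delta2_def by blast
  have "orlicz_haar \<mu> \<phi> \<psi>"
  proof
    fix x y :: real assume "0 \<le> x" "0 \<le> y"
    \<comment> \<open>Young's inequality is one term of the supremum that defines the complementary
      function.\<close>
    then have "ereal (x * y) - \<Phi> x \<le> \<Psi> y"
      unfolding \<Psi> complementary_young_def by (intro SUP_upper2[of x]) auto
    then show "x * y \<le> \<phi> x + \<psi> y"
      by (simp add: \<phi>(1) \<psi>(1) algebra_simps)
  qed (use assms(2) \<phi> \<psi> in auto)
  then show ?thesis
    unfolding \<phi>(1) \<psi>(1) using assms(1,3) by (rule orlicz_haar.reflexive_iff_finite)
qed

end
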